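(* Let $k\ge 0$ be an integer and let $G$ be a connected simple $k$-nearly outerplanar graph on $n$ vertices. Then $$\operatorname{sn}(G)\le (2+\sqrt{2})\sqrt{n}+4+k,$$ where $\operatorname{sn}(G)$ denotes the scramble number of $G$.
   Context: All graphs are finite and simple. A planar graph is outerplanar if it can be embedded in the plane (drawn with no crossing edges) so that all of its vertices lie on the unbounded face. A graph is $k$-nearly outerplanar if it is edgeless or has a subset of at most $k$ edges whose deletion results in an outerplanar graph. Scramble number. A scramble $\mathcal{S}=\{\mathcal{E}_1,\dots,\mathcal{E}_m\}$ on a graph $G$ is a collection of (nonempty) connected subgraphs of $G$, called eggs. A hitting set for $\mathcal{S}$ is a set of vertices of $G$ having nonempty intersection with each egg; the hitting size $h(\mathcal{S})$ is the minimum size of a hitting set. An egg-cut for $\mathcal{S}$ is a set of edges $C(A,B)=\{e\in E(G) : e=\{a,b\},\ a\in A,\ b\in B\}$, where $V(G)=A\sqcup B$ and at least one egg has all its vertices in $A$ and at least one egg has all its vertices in $B$. The egg-cut size $e(\mathcal{S})$ is the minimum number of edges in an egg-cut, with $e(\mathcal{S})=\infty$ if there is no egg-cut. The order of $\mathcal{S}$ is $\|\mathcal{S}\|=\min\{h(\mathcal{S}),e(\mathcal{S})\}$, and $\operatorname{sn}(G)$ is the maximum of $\|\mathcal{S}\|$ over all scrambles $\mathcal{S}$ on $G$. *)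

theory Defs
  imports "HOL-Analysis.Analysis" "HOL-Library.Extended_Nat"
begin

datatype 'a graph = Graph (verts: "'a set") (edges: "'a set set")

definition simple_graph :: "'a graph \<Rightarrow> bool" where
  "simple_graph G \<longleftrightarrow> finite (verts G) \<and> (\<forall>e\<in>edges G. e \<subseteq> verts G \<and> card e = 2)"

(* The graph with no vertices counts as connected here; eggs are required to be
   nonempty separately. *)
definition connected_graph :: "'a graph \<Rightarrow> bool" where
  "connected_graph G \<longleftrightarrow>
     (\<forall>u\<in>verts G. \<forall>v\<in>verts G. (u, v) \<in> {(x, y). {x, y} \<in> edges G}\<^sup>*)"

definition subgraph :: "'a graph \<Rightarrow> 'a graph \<Rightarrow> bool" where
  "subgraph H G \<longleftrightarrow> simple_graph H \<and> verts H \<subseteq> verts G \<and> edges H \<subseteq> edges G"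

definition delete_edges :: "'a graph \<Rightarrow> 'a set set \<Rightarrow> 'a graph" where
  "delete_edges G F = Graph (verts G) (edges G - F)"


(* The plane is the type complex. The map p places the vertices and c draws each edge
   as an arc, i.e. an injective path. An arc meets the vertex set exactly in its two
   endpoints, and two arcs meet only in common endpoints. *)
definition plane_embedding ::
    "'a graph \<Rightarrow> ('a \<Rightarrow> complex) \<Rightarrow> ('a set \<Rightarrow> real \<Rightarrow> complex) \<Rightarrow> bool" where
  "plane_embedding G p c \<longleftrightarrow>
     inj_on p (verts G) \<and>
     (\<forall>e\<in>edges G. arc (c e) \<and>
        {pathstart (c e), pathfinish (c e)} = p ` e \<and>
        path_image (c e) \<inter> p ` verts G = p ` e) \<and>
     (\<forall>e\<in>edges G. \<forall>f\<in>edges G. e \<noteq> f \<longrightarrow>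
        path_image (c e) \<inter> path_image (c f) \<subseteq> p ` (e \<inter> f))"

definition drawing ::
    "'a graph \<Rightarrow> ('a \<Rightarrow> complex) \<Rightarrow> ('a set \<Rightarrow> real \<Rightarrow> complex) \<Rightarrow> complex set" where
  "drawing G p c = p ` verts G \<union> (\<Union>e\<in>edges G. path_image (c e))"

(* The faces are the connected components of the complement of the drawing. A vertex,
   being a point of the drawing, lies on a face when it lies on its frontier. *)
definition outerplanar :: "'a graph \<Rightarrow> bool" where
  "outerplanar G \<longleftrightarrow>
     (\<exists>p c. plane_embedding G p c \<and>
        (\<exists>F\<in>components (- drawing G p c). \<not> bounded F \<and> p ` verts G \<subseteq> frontier F))"

definition nearly_outerplanar :: "nat \<Rightarrow> 'a graph \<Rightarrow> bool" where
  "nearly_outerplanar k G \<longleftrightarrow>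
     edges G = {} \<or>
     (\<exists>F\<subseteq>edges G. card F \<le> k \<and> outerplanar (delete_edges G F))"


(* The empty scramble is allowed: its order is 0, so it affects the maximum only by
   making the scramble number of the graph without vertices equal to 0. *)
definition scramble :: "'a graph \<Rightarrow> 'a graph set \<Rightarrow> bool" where
  "scramble G S \<longleftrightarrow>
     (\<forall>H\<in>S. subgraph H G \<and> connected_graph H \<and> verts H \<noteq> {})"

definition hitting_set :: "'a graph \<Rightarrow> 'a graph set \<Rightarrow> 'a set \<Rightarrow> bool" where
  "hitting_set G S X \<longleftrightarrow> X \<subseteq> verts G \<and> (\<forall>H\<in>S. X \<inter> verts H \<noteq> {})"

definition hitting_size :: "'a graph \<Rightarrow> 'a graph set \<Rightarrow> nat" where
  "hitting_size G S = Min (card ` {X. hitting_set G S X})"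

definition cut_edges :: "'a graph \<Rightarrow> 'a set \<Rightarrow> 'a set \<Rightarrow> 'a set set" where
  "cut_edges G A B = {e \<in> edges G. \<exists>a\<in>A. \<exists>b\<in>B. e = {a, b}}"

definition egg_cut :: "'a graph \<Rightarrow> 'a graph set \<Rightarrow> 'a set set \<Rightarrow> bool" where
  "egg_cut G S C \<longleftrightarrow>
     (\<exists>A B. A \<union> B = verts G \<and> A \<inter> B = {} \<and>
        (\<exists>H\<in>S. verts H \<subseteq> A) \<and> (\<exists>H\<in>S. verts H \<subseteq> B) \<and>
        C = cut_edges G A B)"

(* The infimum of the empty set in enat is \<infinity>. *)
definition egg_cut_size :: "'a graph \<Rightarrow> 'a graph set \<Rightarrow> enat" where
  "egg_cut_size G S = (INF C\<in>{C. egg_cut G S C}. enat (card C))"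

(* Never \<infinity>, since the hitting size is finite. *)
definition scramble_order :: "'a graph \<Rightarrow> 'a graph set \<Rightarrow> nat" where
  "scramble_order G S = the_enat (min (enat (hitting_size G S)) (egg_cut_size G S))"

definition scramble_number :: "'a graph \<Rightarrow> nat" where
  "scramble_number G = Max (scramble_order G ` {S. scramble G S})"


text \<open>The minimum and the maximum above range over finite nonempty sets.\<close>

lemma finite_edges: "simple_graph G \<Longrightarrow> finite (edges G)"
  unfolding simple_graph_def by (rule finite_subset[of _ "Pow (verts G)"]) auto

lemma hitting_sets_finite_nonempty:
  assumes "simple_graph G" "scramble G S"
  shows "finite {X. hitting_set G S X}" "{X. hitting_set G S X} \<noteq> {}"
proof -
  have "{X. hitting_set G S X} \<subseteq> Pow (verts G)"
    by (auto simp: hitting_set_def)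
  then show "finite {X. hitting_set G S X}"
    using assms(1) by (auto simp: simple_graph_def intro: finite_subset)
  have "hitting_set G S (verts G)"
    using assms(2) by (fastforce simp: hitting_set_def scramble_def subgraph_def)
  then show "{X. hitting_set G S X} \<noteq> {}" by blast
qed

lemma scrambles_finite_nonempty:
  assumes "simple_graph G"
  shows "finite {S. scramble G S}" "{S. scramble G S} \<noteq> {}"
proof -
  let ?H = "(\<lambda>(V, E). Graph V E) ` (Pow (verts G) \<times> Pow (edges G))"
  have "H \<in> ?H" if "subgraph H G" for H
    using that by (cases H) (auto simp: subgraph_def)
  then have "{S. scramble G S} \<subseteq> Pow ?H"
    by (auto simp: scramble_def)
  moreover have "finite (Pow ?H)"
    using assms finite_edges[OF assms] by (simp add: simple_graph_def)
  ultimately show "finite {S. scramble G S}" by (rule finite_subset)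
  have "scramble G {}" by (simp add: scramble_def)
  then show "{S. scramble G S} \<noteq> {}" by blast
qed

end

theory Submission imports Defs begin

text \<open>The proof yields \<open>3 * sqrt n + 4 + k\<close>, and \<open>3 \<le> 2 + sqrt 2\<close>. It rests on one consequence of
outerplanarity, the absence of a K4 minor after the deletion of at most \<open>k\<close> edges.

\<^bold>\<open>No K4 minor.\<close> In a drawing with all vertices on the frontier of the unbounded face, no vertex lies
inside a closed curve of the drawing, since the unbounded face would then be trapped inside that
curve. A K4 minor would give two vertices \<open>a\<close> and \<open>b\<close>, three internally disjoint arcs \<open>P1\<close>, \<open>P2\<close>, \<open>L\<close>
between them, the first two with vertices in their interior, and an arc \<open>Q\<close> from \<open>P1\<close> to \<open>P2\<close> that
avoids \<open>L\<close>. One of the three arcs of a theta curve always lies inside the closed curve formed by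
the other two (\<open>theta_some_arc_inside\<close>). This forces both \<open>L\<close> and \<open>Q\<close> to run inside the closed curve
\<open>P1 \<union> P2\<close>; their ends alternate on this curve, so they would have to cross (\<open>crossing_chords\<close>).

\<^bold>\<open>Separations.\<close> Without a K4 minor, a connected vertex set \<open>C\<close> that has at most two neighbours, and
whose neighbours are connected outside of it, contains a vertex \<open>y\<close> such that every component of
\<open>C - {y}\<close> is again a set of this kind (\<open>attached_split\<close>). Such sets replace a tree decomposition of
width two. In particular every vertex set \<open>X\<close> spans at most \<open>2 * card X\<close> edges.

\<^bold>\<open>Scrambles.\<close> Take a scramble of order \<open>s + k\<close> and discard the eggs that contain a chosen end of one
of the \<open>k\<close> deleted edges. The other eggs stay connected after the deletion, no set of fewer than \<open>s\<close>
vertices hits them all, and no cut of fewer than \<open>s\<close> edges separates two of them. Put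
\<open>s = t + 4\<close>, let \<open>w\<close> be about \<open>2 * t / 3\<close>, and call vertices of degree at least \<open>w + 2\<close> hubs; there
are at most \<open>2 * n / w\<close> hubs. Let \<open>D\<close> be a minimal attached set that contains an egg and has no
hub among its neighbours. As the neighbours have low degree, \<open>D\<close> can be cut off cheaply, so all eggs
that avoid the neighbours of \<open>D\<close> lie in \<open>D\<close>; and a smaller attached set that contains an egg has a hub
among its at most two neighbours.

Now a hitting set \<open>H\<close> is grown from the hubs and the neighbours of \<open>D\<close> (\<open>sweep\<close>). While some egg avoids
\<open>H\<close>, take a minimal attached set \<open>C\<close> with an egg in the part of \<open>C\<close> that has not been dealt with. At
least \<open>w\<close> edges join this part to \<open>H\<close>, for otherwise it could be cut off cheaply and all eggs would be
hit by the ends of these edges together with two more vertices. Adding the splitting vertex of \<open>C\<close> and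
its at most one neighbour outside \<open>H\<close> settles all eggs that meet \<open>C\<close>. So two new vertices in \<open>H\<close> are paid
for by \<open>w\<close> edges that are never used again. As there are at most \<open>2 * n\<close> edges, the final \<open>H\<close> has at most
\<open>2 + 2 * n / w + 4 * n / w\<close> vertices. It hits every egg, hence \<open>w * (s - 2) \<le> 6 * n\<close>, and
\<open>t\<^sup>2 \<le> 9 * n\<close> follows.\<close>

section \<open>Connected vertex sets and K4 minors\<close>

definition touches :: "'a set set \<Rightarrow> 'a set \<Rightarrow> 'a set \<Rightarrow> bool" where
  "touches E X Y \<longleftrightarrow> (\<exists>x\<in>X. \<exists>y\<in>Y. {x, y} \<in> E)"

text \<open>Connectedness is expressed by cuts: no proper nonempty part of \<open>X\<close> is without an edge to the rest.
Unions, components and edges on which a connected set leaves another set can then be treated without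
mentioning paths.\<close>

definition connected_in :: "'a set set \<Rightarrow> 'a set \<Rightarrow> bool" where
  "connected_in E X \<longleftrightarrow> (\<forall>A. A \<noteq> {} \<and> A \<subset> X \<longrightarrow> touches E A (X - A))"

text \<open>The set \<open>B\<close> accounts for two of the four branch sets of a K4 minor: it is connected, so it splits into
two connected adjacent parts, one containing \<open>a\<close> and the other \<open>b\<close>. Keeping \<open>B\<close> whole suits both sides of
the argument. In a drawing, \<open>B\<close> supplies an arc from \<open>a\<close> to \<open>b\<close>; in the search for separating vertices,
\<open>a\<close> and \<open>b\<close> are the neighbours of \<open>C \<union> D\<close>.\<close>

definition K4_free :: "'a set \<Rightarrow> 'a set set \<Rightarrow> bool" where
  "K4_free V E \<longleftrightarrow> \<not> (\<exists>a b B C D. B \<subseteq> V \<and> C \<subseteq> V \<and> D \<subseteq> V \<and>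
     B \<inter> C = {} \<and> B \<inter> D = {} \<and> C \<inter> D = {} \<and>
     connected_in E B \<and> connected_in E C \<and> connected_in E D \<and>
     a \<in> B \<and> b \<in> B \<and> a \<noteq> b \<and> touches E C D \<and>
     touches E C {a} \<and> touches E C {b} \<and> touches E D {a} \<and> touches E D {b})"

lemma touches_sym: "touches E X Y \<longleftrightarrow> touches E Y X"
  unfolding touches_def by (metis insert_commute)

lemma touches_mono: "touches E X Y \<Longrightarrow> X \<subseteq> X' \<Longrightarrow> Y \<subseteq> Y' \<Longrightarrow> touches E X' Y'"
  unfolding touches_def by blast

lemma connected_inD: "connected_in E X \<Longrightarrow> A \<noteq> {} \<Longrightarrow> A \<subseteq> X \<Longrightarrow> A \<noteq> X \<Longrightarrow> touches E A (X - A)"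
  unfolding connected_in_def by blast

lemma connected_in_singleton: "connected_in E {x}"
  unfolding connected_in_def by blast

lemma connected_in_crossing:
  assumes "connected_in E X" "X \<inter> A \<noteq> {}" "\<not> X \<subseteq> A"
  shows "touches E (X \<inter> A) (X - A)"
proof -
  have "touches E (X \<inter> A) (X - (X \<inter> A))" using assms by (intro connected_inD) auto
  moreover have "X - (X \<inter> A) = X - A" by blast
  ultimately show ?thesis by simp
qed

lemma connected_in_Un:
  assumes X: "connected_in E X" and Y: "connected_in E Y" and XY: "X \<inter> Y \<noteq> {} \<or> touches E X Y"
  shows "connected_in E (X \<union> Y)"
  unfolding connected_in_def
proof (intro allI impI)
  fix A assume A: "A \<noteq> {} \<and> A \<subset> X \<union> Y"
  consider "X \<inter> A \<noteq> {}" "\<not> X \<subseteq> A" | "Y \<inter> A \<noteq> {}" "\<not> Y \<subseteq> A"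
    | "X \<subseteq> A" "Y \<inter> A = {}" | "Y \<subseteq> A" "X \<inter> A = {}"
    using A by blast
  then show "touches E A (X \<union> Y - A)"
  proof cases
    case 1
    then show ?thesis by (intro touches_mono[OF connected_in_crossing[OF X]]) auto
  next
    case 2
    then show ?thesis by (intro touches_mono[OF connected_in_crossing[OF Y]]) auto
  next
    case 3
    then have "touches E X Y" using XY A by blast
    then show ?thesis by (rule touches_mono) (use 3 in auto)
  next
    case 4
    then have "touches E Y X" using XY A touches_sym by blast
    then show ?thesis by (rule touches_mono) (use 4 in auto)
  qed
qed

lemma connected_component_exists:
  assumes "finite X" "connected_in E K" "K \<noteq> {}" "K \<subseteq> X"
  obtains M where "K \<subseteq> M" "M \<subseteq> X" "connected_in E M" "\<not> touches E M (X - M)"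
proof -
  define \<M> where "\<M> = {M. K \<subseteq> M \<and> M \<subseteq> X \<and> connected_in E M}"
  have "finite \<M>" "K \<in> \<M>" using assms by (auto simp: \<M>_def)
  then obtain M where M: "M \<in> \<M>" "\<And>N. N \<in> \<M> \<Longrightarrow> M \<subseteq> N \<Longrightarrow> M = N"
    by (metis finite_has_maximal2)
  have "\<not> touches E M (X - M)"
  proof
    assume "touches E M (X - M)"
    then obtain x where x: "x \<in> X - M" "touches E M {x}" unfolding touches_def by blast
    then have "connected_in E (M \<union> {x})"
      using M(1) by (intro connected_in_Un) (auto simp: \<M>_def connected_in_singleton)
    then have "M \<union> {x} \<in> \<M>" using M(1) x by (auto simp: \<M>_def)
    then show False using M(2)[of "M \<union> {x}"] x by blast
  qed
  with M(1) that show thesis by (auto simp: \<M>_def)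
qed

section \<open>Theta curves in the plane\<close>

text \<open>An inversion \<open>f\<close> centred at a point inside \<open>J\<close> turns the plane inside out: if the component of \<open>f x\<close> in
the complement of \<open>f ` J\<close> were unbounded, its preimage would be a connected set avoiding \<open>J\<close> that
contains the outer point \<open>x\<close> and comes arbitrarily close to the inner point \<open>p\<close>. The free parameter \<open>q\<close>
makes the inverse of \<open>f\<close> a map of the same form.\<close>

lemma inside_inversion:
  fixes J :: "complex set" and p q :: complex
  defines "f \<equiv> \<lambda>z. q + inverse (z - p)"
  assumes J: "compact J" and p: "p \<in> inside J" and x: "x \<in> outside J"
  shows "f x \<in> inside (f ` J)"
proof (rule ccontr)
  define g where "g = (\<lambda>w. p + inverse (w - q))"
  have gf: "g (f z) = z" for z by (simp add: f_def g_def)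
  have fg: "f (g z) = z" for z by (simp add: f_def g_def)
  have pJ: "p \<notin> J" and xJ: "x \<notin> J"
    using p x inside_no_overlap outside_no_overlap by blast+
  have xp: "x \<noteq> p" using p x inside_Int_outside by blast
  have "continuous_on J f" unfolding f_def using pJ by (intro continuous_intros) auto
  then have J': "compact (f ` J)" using J by (rule compact_continuous_image)
  assume "f x \<notin> inside (f ` J)"
  moreover have "f x \<notin> f ` J" using xJ gf by (metis imageE)
  ultimately have "f x \<in> outside (f ` J)" using inside_Un_outside by blast
  define C where "C = connected_component_set (- f ` J) (f x)"
  have ubC: "\<not> bounded C" using \<open>f x \<in> outside (f ` J)\<close> by (simp add: outside C_def)
  \<comment> \<open>The point \<open>q\<close> corresponds to infinity, so it is removed before \<open>g\<close> is applied.\<close>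
  have "open C" unfolding C_def
    using J' by (simp add: compact_imp_closed open_connected_component open_Compl)
  moreover have "connected C" unfolding C_def by simp
  ultimately have conn: "connected (C - {q})" by (intro connected_open_delete) auto
  have ub: "\<not> bounded (C - {q})" using ubC by (metis bounded_insert bounded_subset insert_Diff_single subset_insertI)
  have fxC: "f x \<in> C - {q}"
    using \<open>f x \<notin> f ` J\<close> xp by (simp add: C_def f_def)
  have CJ: "C \<inter> f ` J = {}" unfolding C_def using connected_component_subset by blast
  have "connected (g ` (C - {q}))"
    by (rule connected_continuous_image[OF _ conn]) (auto simp: g_def intro!: continuous_intros)
  moreover have "J \<inter> g ` (C - {q}) = {}" 
  proof -
    have "g w \<notin> J" if "w \<in> C" for w
    proof
      assume "g w \<in> J"
      then have "f (g w) \<in> f ` J" by blast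
      then show False using that CJ fg by auto
    qed
    then show ?thesis by auto
  qed
  moreover have "x \<in> g ` (C - {q})" using fxC gf by (metis image_eqI)
  ultimately have out: "inside J \<inter> g ` (C - {q}) = {}"
    using x inside_outside_intersect_connected[of "g ` (C - {q})" J] by blast
  obtain e where e: "e > 0" "ball p e \<subseteq> inside J"
    using p open_inside[OF compact_imp_closed[OF J]] open_contains_ball by blast
  obtain z where z: "z \<in> C - {q}" "norm z > norm q + 1 / e"
    using ub unfolding bounded_iff by (meson not_le)
  have "norm (z - q) > 1 / e" using z(2) norm_triangle_ineq2[of z q] by linarith
  moreover from this have "norm (z - q) > 0" using e(1) by (smt (verit) divide_pos_pos)
  ultimately have "norm (inverse (z - q)) < e" using e(1)
    by (simp add: norm_inverse inverse_eq_divide norm_divide field_simps)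
  then have "g z \<in> ball p e" by (simp add: g_def dist_norm)
  then show False using out e(2) z(1) by blast
qed

definition theta where
  "theta a b c1 c2 c3 \<longleftrightarrow> a \<noteq> b \<and> (\<forall>c\<in>{c1,c2,c3}. arc c \<and> pathstart c = a \<and> pathfinish c = b) \<and>
     path_image c1 \<inter> path_image c2 = {a,b} \<and> path_image c1 \<inter> path_image c3 = {a,b} \<and>
     path_image c2 \<inter> path_image c3 = {a,b}"

lemma theta_swap12: "theta a b c1 c2 c3 \<Longrightarrow> theta a b c2 c1 c3"
  by (auto simp: theta_def Int_commute)

lemma theta_swap23: "theta a b c1 c2 c3 \<Longrightarrow> theta a b c1 c3 c2"
  by (auto simp: theta_def Int_commute)

lemma theta_split:
  fixes c1 c2 c3 :: "real \<Rightarrow> complex"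
  assumes "theta a b c1 c2 c3" "path_image c3 \<inter> inside (path_image c1 \<union> path_image c2) \<noteq> {}"
  shows "inside (path_image c1 \<union> path_image c3) \<inter> inside (path_image c2 \<union> path_image c3) = {}"
    "inside (path_image c1 \<union> path_image c3) \<union> inside (path_image c2 \<union> path_image c3) \<union>
       (path_image c3 - {a,b}) = inside (path_image c1 \<union> path_image c2)"
proof -
  have "simple_path c1" "simple_path c2" "simple_path c3"
    using assms(1) by (auto simp: theta_def arc_imp_simple_path)
  with assms show "inside (path_image c1 \<union> path_image c3) \<inter> inside (path_image c2 \<union> path_image c3) = {}"
    "inside (path_image c1 \<union> path_image c3) \<union> inside (path_image c2 \<union> path_image c3) \<union>
       (path_image c3 - {a,b}) = inside (path_image c1 \<union> path_image c2)"
    using split_inside_simple_closed_curve[of c1 a b c2 c3] by (auto simp: theta_def)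
qed

lemma theta_compact: "theta a b c1 c2 c3 \<Longrightarrow> compact (path_image c1 \<union> path_image c2)"
  by (auto simp: theta_def arc_imp_path intro!: compact_Un compact_path_image)

lemma theta_Jordan:
  fixes c1 c2 c3 :: "real \<Rightarrow> complex"
  assumes "theta a b c1 c2 c3"
  shows "inside (path_image c1 \<union> path_image c2) \<noteq> {}"
proof -
  let ?c = "c1 +++ reversepath c2"
  have "simple_path ?c" "pathfinish ?c = pathstart ?c"
    using assms by (auto simp: theta_def intro!: simple_path_join_loop arc_reversepath)
  moreover have "path_image ?c = path_image c1 \<union> path_image c2"
    using assms by (subst path_image_join) (auto simp: theta_def)
  ultimately show ?thesis using Jordan_inside_outside[of ?c] by auto
qed

lemma theta_inversion:
  fixes c1 c2 c3 :: "real \<Rightarrow> complex" and p q :: complex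
  defines "f \<equiv> \<lambda>z. q + inverse (z - p)"
  assumes th: "theta a b c1 c2 c3" and p: "p \<notin> path_image c1 \<union> path_image c2 \<union> path_image c3"
  shows "theta (f a) (f b) (f \<circ> c1) (f \<circ> c2) (f \<circ> c3)"
proof -
  have inj: "inj f" by (auto simp: f_def inj_def)
  have arc: "arc (f \<circ> c)" if "c \<in> {c1,c2,c3}" for c
  proof -
    have "arc c" "p \<notin> path_image c" using that th p by (auto simp: theta_def)
    moreover have "path (f \<circ> c)"
      by (rule path_continuous_image)
         (use calculation in \<open>auto simp: arc_imp_path f_def intro!: continuous_intros\<close>)
    ultimately show ?thesis using inj
      by (auto simp: arc_def inj_on_def inj_def)
  qed
  have im: "f ` A \<inter> f ` B = f ` (A \<inter> B)" for A B using inj by (simp add: image_Int)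
  have "f a \<noteq> f b" using th inj by (auto simp: theta_def inj_def)
  moreover have "f ` {a, b} = {f a, f b}" by simp
  ultimately show ?thesis using th arc
    unfolding theta_def by (simp add: path_image_compose im pathstart_compose pathfinish_compose)
qed

text \<open>Suppose that \<open>c3\<close> runs outside of the closed curve \<open>c1 \<union> c2\<close>. Invert the plane at a point inside this
curve. The image of \<open>c3\<close> runs inside the image of \<open>c1 \<union> c2\<close> and divides that region into two, bounded by
the images of \<open>c1 \<union> c3\<close> and of \<open>c2 \<union> c3\<close>. One of them, say the first, contains 0, the image of infinity,
and the image of \<open>c2\<close> is outside of it. Inverting at 0 brings everything back, and now \<open>c2\<close> is inside
\<open>c1 \<union> c3\<close>.\<close>

lemma theta_some_arc_inside:
  fixes c1 c2 c3 :: "real \<Rightarrow> complex"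
  assumes th: "theta a b c1 c2 c3"
  shows "path_image c3 \<inter> inside (path_image c1 \<union> path_image c2) \<noteq> {} \<or>
         path_image c2 \<inter> inside (path_image c1 \<union> path_image c3) \<noteq> {} \<or>
         path_image c1 \<inter> inside (path_image c2 \<union> path_image c3) \<noteq> {}"
proof (rule ccontr)
  assume "\<not> ?thesis"
  then have no3: "path_image c3 \<inter> inside (path_image c1 \<union> path_image c2) = {}"
    and no2: "path_image c2 \<inter> inside (path_image c1 \<union> path_image c3) = {}"
    and no1: "path_image c1 \<inter> inside (path_image c2 \<union> path_image c3) = {}" by auto
  obtain p where p: "p \<in> inside (path_image c1 \<union> path_image c2)" using theta_Jordan[OF th] by blast
  then have p': "p \<notin> path_image c1 \<union> path_image c2 \<union> path_image c3"
    using no3 inside_no_overlap by blast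
  define f where "f = (\<lambda>z. 0 + inverse (z - p))"
  define g where "g = (\<lambda>z. p + inverse (z - 0))"
  have gf: "g (f z) = z" for z by (simp add: f_def g_def)
  have th': "theta (f a) (f b) (f \<circ> c1) (f \<circ> c2) (f \<circ> c3)"
    unfolding f_def by (rule theta_inversion[OF th p'])
  have interior: "\<exists>x. x \<in> path_image c - {a,b}" if "c \<in> {c1,c2,c3}" for c
  proof -
    have "arc c" "pathstart c = a" "pathfinish c = b" using that th by (auto simp: theta_def)
    then have "inj_on c {0..1}" by (simp add: arc_def)
    then have "c (1/2) \<noteq> c 0" "c (1/2) \<noteq> c 1" by (auto dest: inj_onD)
    with \<open>pathstart c = a\<close> \<open>pathfinish c = b\<close> show ?thesis
      by (intro exI[of _ "c (1/2)"]) (auto simp: path_image_def pathstart_def pathfinish_def)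
  qed
  obtain x3 where x3: "x3 \<in> path_image c3 - {a,b}" using interior by blast
  have "x3 \<notin> path_image c1 \<union> path_image c2" using x3 th by (auto simp: theta_def)
  then have "x3 \<in> outside (path_image c1 \<union> path_image c2)"
    using no3 x3 inside_Un_outside[of "path_image c1 \<union> path_image c2"] by blast
  then have "f x3 \<in> inside (f ` (path_image c1 \<union> path_image c2))"
    unfolding f_def by (intro inside_inversion[OF theta_compact[OF th] p])
  then have "path_image (f \<circ> c3) \<inter> inside (path_image (f \<circ> c1) \<union> path_image (f \<circ> c2)) \<noteq> {}"
    using x3 by (auto simp: path_image_compose image_Un)
  from theta_split[OF th' this] have sp:
    "inside (path_image (f \<circ> c1) \<union> path_image (f \<circ> c3)) \<union> inside (path_image (f \<circ> c2) \<union> path_image (f \<circ> c3)) \<union>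
       (path_image (f \<circ> c3) - {f a, f b}) = inside (path_image (f \<circ> c1) \<union> path_image (f \<circ> c2))" by blast
  have enclosed: "path_image d2 \<inter> inside (path_image d1 \<union> path_image c3) \<noteq> {}"
    if zero: "0 \<in> inside (path_image (f \<circ> d1) \<union> path_image (f \<circ> c3))"
      and d: "{d1,d2} = {c1,c2}" and thd: "theta a b d1 d2 c3" for d1 d2
  proof -
    obtain x where x: "x \<in> path_image d2 - {a,b}" using interior d by blast
    have thd': "theta (f a) (f b) (f \<circ> d1) (f \<circ> d2) (f \<circ> c3)"
      unfolding f_def by (rule theta_inversion[OF thd]) (use p' d in auto)
    have inj: "inj f" using gf by (metis injI)
    have "f x \<in> path_image (f \<circ> c1) \<union> path_image (f \<circ> c2)" using x d by (auto simp: path_image_compose)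
    have "f x \<notin> inside (path_image (f \<circ> d1) \<union> path_image (f \<circ> c3))"
    proof -
      have "d1 = c1 \<or> d1 = c2" using d by (auto simp: doubleton_eq_iff)
      then have "inside (path_image (f \<circ> d1) \<union> path_image (f \<circ> c3))
          \<subseteq> inside (path_image (f \<circ> c1) \<union> path_image (f \<circ> c2))"
        using sp by blast
      then show ?thesis
        using \<open>f x \<in> path_image (f \<circ> c1) \<union> path_image (f \<circ> c2)\<close>
          inside_no_overlap[of "path_image (f \<circ> c1) \<union> path_image (f \<circ> c2)"] by blast
    qed
    moreover have "x \<notin> path_image d1 \<union> path_image c3" using x thd by (auto simp: theta_def)
    then have "f x \<notin> path_image (f \<circ> d1) \<union> path_image (f \<circ> c3)"
      using inj by (auto simp: path_image_compose inj_def)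
    ultimately have "f x \<in> outside (path_image (f \<circ> d1) \<union> path_image (f \<circ> c3))"
      using inside_Un_outside by blast
    then have "g (f x) \<in> inside (g ` (path_image (f \<circ> d1) \<union> path_image (f \<circ> c3)))"
      unfolding g_def by (intro inside_inversion[OF theta_compact[OF theta_swap23[OF thd']] zero])
    also have "g ` (path_image (f \<circ> d1) \<union> path_image (f \<circ> c3)) = path_image d1 \<union> path_image c3"
      by (simp add: path_image_compose image_Un image_image gf)
    finally show ?thesis using x gf by auto
  qed
  \<comment> \<open>Images of points far away are inside and arbitrarily close to 0.\<close>
  have "0 \<in> inside (f ` (path_image c1 \<union> path_image c2))"
  proof -
    have "0 \<notin> f ` (path_image c1 \<union> path_image c2)" using p' by (auto simp: f_def)
    moreover have "0 \<notin> outside (f ` (path_image c1 \<union> path_image c2))"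
    proof
      assume 0: "0 \<in> outside (f ` (path_image c1 \<union> path_image c2))"
      have "compact (f ` (path_image c1 \<union> path_image c2))"
        using theta_compact[OF th'] by (simp add: path_image_compose image_Un)
      then obtain e where e: "e > 0" "ball 0 e \<subseteq> outside (f ` (path_image c1 \<union> path_image c2))"
        using 0 open_outside[OF compact_imp_closed] open_contains_ball by blast
      have "\<not> bounded (outside (path_image c1 \<union> path_image c2))"
        using theta_compact[OF th] compact_imp_bounded unbounded_outside by blast
      then obtain z where z: "z \<in> outside (path_image c1 \<union> path_image c2)" "norm z > norm p + 1 / e"
        unfolding bounded_iff by (meson not_le)
      have *: "norm (z - p) > 1 / e" using z(2) norm_triangle_ineq2[of z p] by linarith
      then have "norm (z - p) > 0" using e(1) by (smt (verit) divide_pos_pos)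
      then have "norm (f z) < e" using e(1) * 
        by (simp add: f_def norm_inverse inverse_eq_divide norm_divide field_simps)
      then have "f z \<in> outside (f ` (path_image c1 \<union> path_image c2))" using e(2) by auto
      moreover have "f z \<in> inside (f ` (path_image c1 \<union> path_image c2))"
        unfolding f_def by (intro inside_inversion[OF theta_compact[OF th] p z(1)])
      ultimately show False using inside_Int_outside by blast
    qed
    ultimately show ?thesis using inside_Un_outside by blast
  qed
  moreover have "0 \<notin> path_image (f \<circ> c3)" using p' by (auto simp: f_def path_image_compose)
  ultimately have "0 \<in> inside (path_image (f \<circ> c1) \<union> path_image (f \<circ> c3)) \<or>
      0 \<in> inside (path_image (f \<circ> c2) \<union> path_image (f \<circ> c3))"
    using sp by (auto simp: path_image_compose image_Un)
  then show False
    using enclosed[of c1 c2] enclosed[of c2 c1] th theta_swap12[OF th] no1 no2 by auto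
qed

text \<open>If \<open>c1\<close> or \<open>c2\<close> were the arc inside the other two, then all of its interior would be there, including \<open>x1\<close>
or \<open>x2\<close>. In the application these points are vertices on the outer face.\<close>

lemma theta_third_inside:
  fixes c1 c2 c3 :: "real \<Rightarrow> complex"
  assumes th: "theta a b c1 c2 c3"
    and "x1 \<in> path_image c1 - {a,b}" "x1 \<notin> inside (path_image c2 \<union> path_image c3)"
    and "x2 \<in> path_image c2 - {a,b}" "x2 \<notin> inside (path_image c1 \<union> path_image c3)"
  shows "path_image c3 \<inter> inside (path_image c1 \<union> path_image c2) \<noteq> {}"
  using theta_some_arc_inside[OF th]
    theta_split(2)[OF theta_swap23[OF th]]
    theta_split(2)[OF theta_swap23[OF theta_swap12[OF th]]] assms(2-)
  by (metis (no_types, lifting) Un_iff)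

section \<open>Chords of a closed curve with alternating ends\<close>

lemma arc_split:
  fixes g :: "real \<Rightarrow> 'a::real_normed_vector"
  assumes g: "arc g" "x \<in> path_image g" "x \<noteq> pathstart g" "x \<noteq> pathfinish g"
  obtains g1 g2 where "arc g1" "pathstart g1 = pathstart g" "pathfinish g1 = x"
    "arc g2" "pathstart g2 = x" "pathfinish g2 = pathfinish g"
    "path_image g1 \<union> path_image g2 = path_image g" "path_image g1 \<inter> path_image g2 = {x}"
proof -
  obtain u where u: "u \<in> {0..1}" "x = g u" using g(2) by (auto simp: path_image_def)
  have u': "u \<noteq> 0" "u \<noteq> 1" using u g(3,4) by (auto simp: pathstart_def pathfinish_def)
  have inj: "inj_on g {0..1}" using g(1) by (simp add: arc_def)
  have im: "path_image (subpath 0 u g) = g ` {0..u}" "path_image (subpath u 1 g) = g ` {u..1}"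
    using u by (auto simp: path_image_subpath)
  show thesis
  proof
    show "arc (subpath 0 u g)" "arc (subpath u 1 g)"
      using g(1) u u' by (auto intro!: arc_subpath_arc)
    show "path_image (subpath 0 u g) \<union> path_image (subpath u 1 g) = path_image g"
      unfolding im unfolding path_image_def image_Un[symmetric] using u by (simp add: ivl_disj_un)
    have "g ` {0..u} \<inter> g ` {u..1} = g ` ({0..u} \<inter> {u..1})"
      by (rule inj_on_image_Int[OF inj, symmetric]) (use u in auto)
    also have "{0..u} \<inter> {u..1} = {u}" using u by auto
    finally show "path_image (subpath 0 u g) \<inter> path_image (subpath u 1 g) = {x}"
      unfolding im using u by simp
  qed (auto simp: u pathstart_def pathfinish_def subpath_def)
qed

lemma arc_to_closed:
  fixes g :: "real \<Rightarrow> 'a::real_normed_vector"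
  assumes g: "arc g" "closed T" "pathstart g \<notin> T" "pathfinish g \<in> T"
  obtains h where "arc h" "pathstart h = pathstart g" "path_image h \<subseteq> path_image g"
    "path_image h \<inter> T = {pathfinish h}"
proof -
  have path: "path g" using g(1) arc_imp_path by blast
  obtain u where u: "0 \<le> u" "u \<le> 1" "g u \<in> frontier (-T)"
    "path_image (subpath 0 u g) - {g u} \<subseteq> interior (-T)"
    using subpath_to_frontier[OF path, of "-T"] g closure_subset by blast
  have guT: "g u \<in> T" using u(3) g(2) by (metis frontier_complement frontier_subset_closed subsetD)
  have u0: "u \<noteq> 0" using guT g(3) by (auto simp: pathstart_def)
  have fin: "pathfinish (subpath 0 u g) = g u" by simp
  show thesis
  proof
    show "arc (subpath 0 u g)" using g(1) u u0 by (auto intro!: arc_subpath_arc)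
    show "pathstart (subpath 0 u g) = pathstart g" by (simp add: pathstart_def subpath_def)
    show "path_image (subpath 0 u g) \<subseteq> path_image g" using u by (intro path_image_subpath_subset) auto
    have "g u \<in> path_image (subpath 0 u g)" using pathfinish_in_path_image fin by metis
    moreover have "path_image (subpath 0 u g) - {g u} \<subseteq> - T" using u(4) interior_subset by blast
    ultimately show "path_image (subpath 0 u g) \<inter> T = {pathfinish (subpath 0 u g)}"
      unfolding fin using guT by blast
  qed
qed

lemma arc_between_closed:
  assumes g: "path g" "closed S" "closed T" "pathstart g \<in> S" "pathfinish g \<in> T"
    and disj: "path_image g \<inter> S \<inter> T = {}"
  obtains h :: "real \<Rightarrow> complex" where "arc h" "path_image h \<subseteq> path_image g"
    "path_image h \<inter> S = {pathstart h}" "path_image h \<inter> T = {pathfinish h}"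
proof -
  have notin: "pathstart g \<notin> T" "pathfinish g \<notin> S"
    using g disj pathstart_in_path_image pathfinish_in_path_image by blast+
  then have "pathstart g \<noteq> pathfinish g" using g by auto
  then obtain k where k: "arc k" "path_image k \<subseteq> path_image g" "pathstart k = pathstart g" "pathfinish k = pathfinish g"
    using path_contains_arc[OF g(1)] by metis
  obtain h1 where h1: "arc h1" "pathstart h1 = pathstart k" "path_image h1 \<subseteq> path_image k"
    "path_image h1 \<inter> T = {pathfinish h1}"
    using arc_to_closed[OF k(1) g(3)] k notin g by metis
  have "pathfinish h1 \<in> path_image g \<inter> T" using h1 k by blast
  then have "pathfinish h1 \<notin> S" using disj by blast
  then obtain h2 where h2: "arc h2" "pathstart h2 = pathfinish h1" "path_image h2 \<subseteq> path_image h1"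
    "path_image h2 \<inter> S = {pathfinish h2}"
    using arc_to_closed[of "reversepath h1" S] h1 k g by (auto simp: arc_reversepath)
  have "pathstart h2 \<in> path_image h2" by (rule pathstart_in_path_image)
  moreover have "path_image h2 \<inter> T \<subseteq> path_image h1 \<inter> T" using h2(3) by (rule Int_mono) simp
  moreover have "pathstart h2 \<in> T" using h1(4) h2(2) by auto
  ultimately have "path_image h2 \<inter> T = {pathstart h2}" using h1(4) h2(2) by auto
  show thesis
  proof
    show "arc (reversepath h2)" using h2(1) by (rule arc_reversepath)
    show "path_image (reversepath h2) \<subseteq> path_image g" using h2(3) h1(3) k(2) by simp
    show "path_image (reversepath h2) \<inter> S = {pathstart (reversepath h2)}"
      "path_image (reversepath h2) \<inter> T = {pathfinish (reversepath h2)}"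
      using h2(4) \<open>path_image h2 \<inter> T = {pathstart h2}\<close> by simp_all
  qed
qed

lemma arc_ends_in_closure:
  fixes g :: "real \<Rightarrow> 'a::real_normed_vector"
  assumes "arc g"
  shows "{pathstart g, pathfinish g} \<subseteq> closure (path_image g - {pathstart g, pathfinish g})"
proof -
  have "g ` closure {0<..<1} \<subseteq> closure (g ` {0<..<1})"
    using assms by (intro image_closure_subset) (auto simp: arc_def path_def closure_subset)
  then show ?thesis
    using simple_path_endless[OF arc_imp_simple_path[OF assms]]
    by (auto simp: pathstart_def pathfinish_def)
qed

text \<open>The arcs \<open>L\<close> and \<open>Q\<close> are chords of the closed curve \<open>P1 \<union> P2\<close> whose ends alternate. The points of \<open>Z\<close> (vertices,
later) are outside of every closed curve in the drawing \<open>D\<close>, and this puts both chords on the inner side: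
for \<open>L\<close> because \<open>P1\<close> and \<open>P2\<close> pass through points of \<open>Z\<close>, for \<open>Q\<close> because \<open>A\<close> and \<open>B\<close> themselves are such
points on the two halves of the curve between the ends of \<open>Q\<close>. But \<open>L\<close> divides the inner side into two
regions, \<open>Q\<close> stays in one of them, and the closure of each region misses one of the ends of \<open>Q\<close>.\<close>

lemma crossing_chords:
  fixes P1 P2 L Q :: "real \<Rightarrow> complex"
  assumes th: "theta A B P1 P2 L"
    and Q: "arc Q" "pathstart Q \<in> path_image P1 - {A,B}" "pathfinish Q \<in> path_image P2 - {A,B}"
      "path_image Q \<inter> path_image P1 = {pathstart Q}" "path_image Q \<inter> path_image P2 = {pathfinish Q}"
      "path_image Q \<inter> path_image L = {}"
    and Z: "A \<in> Z" "B \<in> Z" "v1 \<in> Z" "v2 \<in> Z" "v1 \<in> path_image P1 - {A,B}" "v2 \<in> path_image P2 - {A,B}"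
    and D: "path_image P1 \<union> path_image P2 \<union> path_image L \<union> path_image Q \<subseteq> D"
    and outer: "\<And>J z. compact J \<Longrightarrow> J \<subseteq> D \<Longrightarrow> z \<in> Z \<Longrightarrow> z \<notin> inside J"
  shows False
proof -
  have arcs: "arc P1" "arc P2" "arc L" "pathstart P1 = A" "pathfinish P1 = B"
    "pathstart P2 = A" "pathfinish P2 = B" and AB: "A \<noteq> B" "path_image P1 \<inter> path_image P2 = {A,B}"
    using th by (auto simp: theta_def)
  define X Y where "X = pathstart Q" and "Y = pathfinish Q"
  let ?J = "path_image P1 \<union> path_image P2"
  have out: "z \<notin> inside (path_image r \<union> path_image s)"
    if "z \<in> Z" "arc r" "arc s" "path_image r \<subseteq> D" "path_image s \<subseteq> D" for r s z
    using that by (intro outer) (auto intro!: compact_Un compact_path_image arc_imp_path)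
  have sub: "path_image P1 \<subseteq> D" "path_image P2 \<subseteq> D" "path_image L \<subseteq> D" "path_image Q \<subseteq> D"
    using D by auto
  have L_in: "path_image L \<inter> inside ?J \<noteq> {}"
  proof (rule theta_third_inside[OF th])
    show "v1 \<notin> inside (path_image P2 \<union> path_image L)" "v2 \<notin> inside (path_image P1 \<union> path_image L)"
      by (intro out; use Z sub arcs in simp)+
  qed (use Z in auto)
  have XP1: "X \<in> path_image P1" "X \<noteq> A" "X \<noteq> B" and YP2: "Y \<in> path_image P2" "Y \<noteq> A" "Y \<noteq> B"
    using Q by (auto simp: X_def Y_def)
  obtain g1 h1 where P1: "arc g1" "pathstart g1 = A" "pathfinish g1 = X"
    "arc h1" "pathstart h1 = X" "pathfinish h1 = B"
    "path_image g1 \<union> path_image h1 = path_image P1" "path_image g1 \<inter> path_image h1 = {X}"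
    by (rule arc_split[OF arcs(1) XP1(1), unfolded arcs(4-7), OF XP1(2,3)])
  obtain g2 h2 where P2: "arc g2" "pathstart g2 = A" "pathfinish g2 = Y"
    "arc h2" "pathstart h2 = Y" "pathfinish h2 = B"
    "path_image g2 \<union> path_image h2 = path_image P2" "path_image g2 \<inter> path_image h2 = {Y}"
    by (rule arc_split[OF arcs(2) YP2(1), unfolded arcs(4-7), OF YP2(2,3)])
  note XY = XP1 YP2
  have ends: "A \<in> path_image g1" "X \<in> path_image g1" "X \<in> path_image h1" "B \<in> path_image h1"
    "A \<in> path_image g2" "Y \<in> path_image g2" "Y \<in> path_image h2" "B \<in> path_image h2"
    using pathstart_in_path_image[of g1] pathfinish_in_path_image[of g1]
      pathstart_in_path_image[of h1] pathfinish_in_path_image[of h1]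
      pathstart_in_path_image[of g2] pathfinish_in_path_image[of g2]
      pathstart_in_path_image[of h2] pathfinish_in_path_image[of h2]
    unfolding P1(2,3,5,6) P2(2,3,5,6) by simp_all
  have "B \<notin> path_image g1" using ends(4) P1(8) XY(3) by (metis IntI singletonD)
  moreover have "A \<notin> path_image h1" using ends(1) P1(8) XY(2) by (metis IntI singletonD)
  moreover have "B \<notin> path_image g2" using ends(8) P2(8) XY(6) by (metis IntI singletonD)
  moreover have "A \<notin> path_image h2" using ends(5) P2(8) XY(5) by (metis IntI singletonD)
  moreover have "X \<notin> path_image P2" using XY(1-3) AB(2) by (metis IntI insertE singletonD)
  moreover have "Y \<notin> path_image P1" using XY(4-6) AB(2) by (metis IntI insertE singletonD)
  ultimately have nots: "B \<notin> path_image g1" "A \<notin> path_image h1" "B \<notin> path_image g2"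
    "A \<notin> path_image h2" "X \<notin> path_image P2" "Y \<notin> path_image P1" by simp_all
  \<comment> \<open>The halves of the closed curve between the ends of \<open>Q\<close>, through \<open>A\<close> and through \<open>B\<close>.\<close>
  define R1 R2 where "R1 = reversepath g1 +++ g2" and "R2 = h1 +++ reversepath h2"
  have R1im: "path_image R1 = path_image g1 \<union> path_image g2"
    unfolding R1_def by (subst path_image_join) (use P1 P2 in auto)
  have R2im: "path_image R2 = path_image h1 \<union> path_image h2"
    unfolding R2_def by (subst path_image_join) (use P1 P2 in auto)
  have "path_image g1 \<inter> path_image g2 \<subseteq> {A,B}" "path_image h1 \<inter> path_image h2 \<subseteq> {A,B}"
    "path_image g1 \<inter> path_image h2 \<subseteq> {A,B}" "path_image g2 \<inter> path_image h1 \<subseteq> {A,B}"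
    unfolding AB(2)[symmetric] P1(7)[symmetric] P2(7)[symmetric] by auto
  then have g12: "path_image g1 \<inter> path_image g2 = {A}" and h12: "path_image h1 \<inter> path_image h2 = {B}"
    and gh: "path_image g1 \<inter> path_image h2 = {}" "path_image g2 \<inter> path_image h1 = {}"
    using ends nots by auto
  have "arc R1" unfolding R1_def
    by (rule arc_join) (use P1 P2 g12 in \<open>auto simp: arc_reversepath\<close>)
  have "arc R2" unfolding R2_def
    by (rule arc_join) (use P1 P2 h12 in \<open>auto simp: arc_reversepath\<close>)
  have R12: "path_image R1 \<union> path_image R2 = ?J" using R1im R2im P1(7) P2(7) by blast
  have R12': "path_image R1 \<inter> path_image R2 = {X,Y}"
  proof -
    have "(path_image g1 \<union> path_image g2) \<inter> (path_image h1 \<union> path_image h2) =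
        (path_image g1 \<inter> path_image h1) \<union> (path_image g1 \<inter> path_image h2) \<union>
        (path_image g2 \<inter> path_image h1) \<union> (path_image g2 \<inter> path_image h2)" by blast
    then show ?thesis unfolding R1im R2im P1(8) P2(8) gh by auto
  qed
  have QX: "X \<in> path_image Q" "Y \<in> path_image Q" by (auto simp: X_def Y_def)
  have Qint: "path_image Q \<inter> path_image P1 = {X}" "path_image Q \<inter> path_image P2 = {Y}"
    using Q X_def Y_def by auto
  have th2: "theta X Y R1 R2 Q"
  proof -
    have "path_image Q \<inter> (path_image P1 \<union> path_image P2) = {X,Y}" using Qint by blast
    then have "path_image Q \<inter> (path_image R1 \<union> path_image R2) = {X,Y}" unfolding R12 .
    then have "path_image R1 \<inter> path_image Q = {X,Y}" "path_image R2 \<inter> path_image Q = {X,Y}"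
      using R12' by auto
    moreover have "X \<noteq> Y" using nots XY by metis
    moreover have "pathstart R1 = X" "pathfinish R1 = Y" "pathstart R2 = X" "pathfinish R2 = Y"
      using P1 P2 by (auto simp: R1_def R2_def)
    ultimately show ?thesis using \<open>arc R1\<close> \<open>arc R2\<close> Q(1) R12'
      by (auto simp: theta_def X_def Y_def)
  qed
  have "path_image Q \<inter> inside (path_image R1 \<union> path_image R2) \<noteq> {}"
  proof (rule theta_third_inside[OF th2])
    show "A \<in> path_image R1 - {X,Y}" "B \<in> path_image R2 - {X,Y}"
      using XY ends R1im R2im by auto
    have "path_image R1 \<subseteq> D" "path_image R2 \<subseteq> D"
      using D R12 by blast+
    then show "A \<notin> inside (path_image R2 \<union> path_image Q)" "B \<notin> inside (path_image R1 \<union> path_image Q)"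
      by (intro out; use Z sub Q(1) \<open>arc R1\<close> \<open>arc R2\<close> in simp)+
  qed
  from theta_split(2)[OF th2 this] have Q_in: "path_image Q - {X,Y} \<subseteq> inside ?J"
    unfolding R12 by blast
  let ?I1 = "inside (path_image P1 \<union> path_image L)" and ?I2 = "inside (path_image P2 \<union> path_image L)"
  note split = theta_split[OF th L_in]
  have cov: "path_image Q - {X,Y} \<subseteq> ?I1 \<union> ?I2"
    using Q_in split(2) Q(6) by blast
  have "connected (path_image Q - {X,Y})"
    unfolding X_def Y_def using Q(1) by (intro connected_simple_path_endless arc_imp_simple_path)
  have closed: "closed (path_image P1 \<union> path_image L)" "closed (path_image P2 \<union> path_image L)"
    using arcs by (auto intro!: closed_Un closed_path_image arc_imp_path)
  then have "open ?I1" "open ?I2" by (auto intro: open_inside)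
  then have "?I1 \<inter> (path_image Q - {X,Y}) = {} \<or> ?I2 \<inter> (path_image Q - {X,Y}) = {}"
    using \<open>connected (path_image Q - {X,Y})\<close> cov split(1) by (intro connectedD) auto
  then have one: "path_image Q - {X,Y} \<subseteq> ?I1 \<or> path_image Q - {X,Y} \<subseteq> ?I2"
    using cov by blast
  have clo: "{X, Y} \<subseteq> closure (path_image Q - {X,Y})"
    unfolding X_def Y_def
    by (rule arc_ends_in_closure[OF Q(1)])
  have "X \<notin> inside ?J" "Y \<notin> inside ?J" using XY inside_no_overlap by blast+
  then have no: "X \<notin> ?I1 \<union> ?I2" "Y \<notin> ?I1 \<union> ?I2" using split(2) by blast+
  from one show False
  proof
    assume "path_image Q - {X,Y} \<subseteq> ?I1"
    then have "Y \<in> closure ?I1" using clo closure_mono by blast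
    then have "Y \<in> path_image P1 \<union> path_image L"
      using closure_inside_subset[OF closed(1)] no by blast
    then show False using nots QX Q(6) by blast
  next
    assume "path_image Q - {X,Y} \<subseteq> ?I2"
    then have "X \<in> closure ?I2" using clo closure_mono by blast
    then have "X \<in> path_image P2 \<union> path_image L"
      using closure_inside_subset[OF closed(2)] no by blast
    then show False using nots QX Q(6) by blast
  qed
qed

section \<open>Outerplanar graphs have no K4 minor\<close>

text \<open>A face with a frontier point inside \<open>J\<close> reaches into the open set inside \<open>J\<close>; it is connected and does not
meet \<open>J\<close>, so it stays there and is bounded.\<close>

lemma frontier_unbounded_face_not_inside:
  assumes F: "F \<in> components (- D)" "\<not> bounded F" "z \<in> frontier F"
    and J: "compact J" "J \<subseteq> D"
  shows "z \<notin> inside (J :: complex set)"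
proof
  assume "z \<in> inside J"
  moreover have "open (inside J)" using J(1) by (simp add: compact_imp_closed open_inside)
  moreover have "z \<in> closure F" using F(3) by (simp add: frontier_def)
  ultimately have "inside J \<inter> F \<noteq> {}" using open_Int_closure_eq_empty by blast
  moreover have "F \<inter> J = {}" using in_components_subset[OF F(1)] J(2) by blast
  moreover have "connected F" using F(1) in_components_connected by blast
  ultimately have "outside J \<inter> F = {}" using inside_outside_intersect_connected[of F J] by blast
  then have "F \<subseteq> inside J" using \<open>F \<inter> J = {}\<close> inside_Un_outside[of J] by blast
  then show False using F(2) J(1) bounded_inside compact_imp_bounded bounded_subset by blast
qed

definition drawn :: "('a \<Rightarrow> complex) \<Rightarrow> ('a set \<Rightarrow> real \<Rightarrow> complex) \<Rightarrow> 'a set set \<Rightarrow> 'a set \<Rightarrow> complex set" where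
  "drawn p c E X = p ` X \<union> (\<Union>e\<in>{e\<in>E. e \<subseteq> X}. path_image (c e))"

context
  fixes V :: "'a set" and E :: "'a set set" and p c
  assumes simple: "simple_graph (Graph V E)" and emb: "plane_embedding (Graph V E) p c"
begin

lemma edge_sub: "e \<in> E \<Longrightarrow> e \<subseteq> V" and edge_card: "e \<in> E \<Longrightarrow> card e = 2"
  using simple by (auto simp: simple_graph_def)

lemma p_inj: "x \<in> V \<Longrightarrow> y \<in> V \<Longrightarrow> p x = p y \<Longrightarrow> x = y"
  using emb by (auto simp: plane_embedding_def inj_on_def)

lemma edge_arc: "e \<in> E \<Longrightarrow> arc (c e)" "e \<in> E \<Longrightarrow> {pathstart (c e), pathfinish (c e)} = p ` e"
  "e \<in> E \<Longrightarrow> path_image (c e) \<inter> p ` V = p ` e"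
  using emb by (auto simp: plane_embedding_def)

lemma edges_meet: "e \<in> E \<Longrightarrow> f \<in> E \<Longrightarrow> e \<noteq> f \<Longrightarrow> path_image (c e) \<inter> path_image (c f) \<subseteq> p ` (e \<inter> f)"
  using emb by (auto simp: plane_embedding_def)

lemma edge_endpoints: "{a, b} \<in> E \<Longrightarrow> a \<in> V \<and> b \<in> V \<and> a \<noteq> b"
  using edge_sub[of "{a,b}"] edge_card[of "{a,b}"] by (auto simp: card_2_iff doubleton_eq_iff)

lemma directed_edge_arc:
  assumes "{a, b} \<in> E"
  obtains g where "arc g" "pathstart g = p a" "pathfinish g = p b" "path_image g = path_image (c {a, b})"
proof -
  have ends: "{pathstart (c {a,b}), pathfinish (c {a,b})} = {p a, p b}"
    using edge_arc(2)[OF assms] by simp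
  then consider "pathstart (c {a,b}) = p a" "pathfinish (c {a,b}) = p b"
    | "pathstart (c {a,b}) = p b" "pathfinish (c {a,b}) = p a"
    by (auto simp: doubleton_eq_iff)
  then show thesis
  proof cases
    case 1
    then show ?thesis using that[of "c {a,b}"] edge_arc(1)[OF assms] by simp
  next
    case 2
    then show ?thesis using that[of "reversepath (c {a,b})"] edge_arc(1)[OF assms]
      by (simp add: arc_reversepath)
  qed
qed

lemma drawn_Int_edge:
  assumes "X \<subseteq> V" "e \<in> E" "\<not> e \<subseteq> X"
  shows "drawn p c E X \<inter> path_image (c e) \<subseteq> p ` (X \<inter> e)"
proof
  fix z assume z: "z \<in> drawn p c E X \<inter> path_image (c e)"
  then consider x where "x \<in> X" "z = p x" | f where "f \<in> E" "f \<subseteq> X" "z \<in> path_image (c f)"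
    by (auto simp: drawn_def)
  then show "z \<in> p ` (X \<inter> e)"
  proof cases
    case 1
    then have "z \<in> p ` e" using edge_arc(3)[OF assms(2)] z assms(1) by blast
    then show ?thesis using 1 p_inj assms edge_sub by blast
  next
    case 2
    then have "f \<noteq> e" using assms(3) by blast
    then show ?thesis using edges_meet[OF 2(1) assms(2)] 2 z by blast
  qed
qed

lemma drawn_disjoint:
  assumes X: "X \<subseteq> V" and Y: "Y \<subseteq> V" and disj: "X \<inter> Y = {}"
  shows "drawn p c E X \<inter> drawn p c E Y = {}"
proof -
  have "z \<notin> drawn p c E X" if z: "z \<in> drawn p c E Y" for z
  proof
    assume zX: "z \<in> drawn p c E X"
    from z consider y where "y \<in> Y" "z = p y" | f where "f \<in> E" "f \<subseteq> Y" "z \<in> path_image (c f)"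
      by (auto simp: drawn_def)
    then show False
    proof cases
      case 1
      from zX consider x where "x \<in> X" "z = p x" | e where "e \<in> E" "e \<subseteq> X" "z \<in> path_image (c e)"
        by (auto simp: drawn_def)
      then show ?thesis
      proof cases
        case (1 x)
        then show ?thesis using \<open>z = p y\<close> \<open>y \<in> Y\<close> p_inj[of x y] X Y disj by blast
      next
        case (2 e)
        then have "p y \<in> p ` e" using \<open>z = p y\<close> \<open>y \<in> Y\<close> Y edge_arc(3)[of e] by blast
        then obtain x where "x \<in> e" "p x = p y" by auto
        then show ?thesis using 2 \<open>y \<in> Y\<close> p_inj[of x y] X Y disj by blast
      qed
    next
      case 2
      have "f \<noteq> {}" using edge_card[OF 2(1)] by auto
      then have "\<not> f \<subseteq> X" using 2(2) disj by blast
      then have "z \<in> p ` (X \<inter> f)" using drawn_Int_edge[OF X 2(1)] zX 2(3) by blast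
      then show ?thesis using 2(2) disj by blast
    qed
  qed
  then show ?thesis by blast
qed

lemma drawn_path_component:
  assumes X: "connected_in E X" and uv: "u \<in> X" "v \<in> X"
  shows "path_component (drawn p c E X) (p u) (p v)"
proof -
  define A where "A = {v \<in> X. path_component (drawn p c E X) (p u) (p v)}"
  have uA: "u \<in> A" using uv by (auto simp: A_def drawn_def intro: path_component_refl)
  have "A = X"
  proof (rule ccontr)
    assume "A \<noteq> X"
    then have "touches E A (X - A)" using connected_inD[OF X, of A] uA by (auto simp: A_def)
    then obtain a b where ab: "a \<in> A" "b \<in> X" "b \<notin> A" "{a, b} \<in> E" by (auto simp: touches_def)
    obtain g where g: "arc g" "pathstart g = p a" "pathfinish g = p b" "path_image g = path_image (c {a, b})"
      using directed_edge_arc[OF ab(4)] by blast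
    have "path_image g \<subseteq> drawn p c E X" using ab g(4) by (auto simp: drawn_def A_def)
    then have "path_component (drawn p c E X) (p a) (p b)"
      using g arc_imp_path unfolding path_component_def by metis
    then have "b \<in> A" using ab path_component_trans unfolding A_def by blast
    then show False using ab by blast
  qed
  then show ?thesis using uv by (auto simp: A_def)
qed

lemma drawn_arc:
  assumes "connected_in E X" "X \<subseteq> V" "u \<in> X" "v \<in> X" "u \<noteq> v"
  obtains g where "arc g" "pathstart g = p u" "pathfinish g = p v" "path_image g \<subseteq> drawn p c E X"
proof -
  obtain h where h: "path h" "pathstart h = p u" "pathfinish h = p v" "path_image h \<subseteq> drawn p c E X"
    using drawn_path_component[OF assms(1,3,4)] by (auto simp: path_component_def)
  have "p u \<noteq> p v" using p_inj assms by blast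
  then obtain q where "arc q" "path_image q \<subseteq> path_image h" "pathstart q = p u" "pathfinish q = p v"
    using path_contains_arc[OF h(1-3)] by blast
  then show thesis using that h(4) by blast
qed

text \<open>The arc consists of the first edge, an arc within the drawing of \<open>X\<close>, and the last edge. It passes through
the vertex \<open>x\<close>, which will prevent it from running inside a closed curve of the drawing.\<close>

lemma arc_through:
  assumes X: "connected_in E X" "X \<subseteq> V" and ab: "a \<notin> X" "b \<notin> X" "a \<noteq> b"
    and x: "x \<in> X" "{a, x} \<in> E" and y: "y \<in> X" "{y, b} \<in> E"
  obtains g where "arc g" "pathstart g = p a" "pathfinish g = p b" "p x \<in> path_image g"
    "path_image g \<subseteq> drawn p c E X \<union> path_image (c {a, x}) \<union> path_image (c {y, b})"
proof -
  obtain g1 where g1: "arc g1" "pathstart g1 = p a" "pathfinish g1 = p x" "path_image g1 = path_image (c {a, x})"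
    using directed_edge_arc[OF x(2)] by blast
  obtain g2 where g2: "arc g2" "pathstart g2 = p y" "pathfinish g2 = p b" "path_image g2 = path_image (c {y, b})"
    using directed_edge_arc[OF y(2)] by blast
  have px: "p x \<in> path_image g1" using g1 pathfinish_in_path_image by metis
  have "{a, x} \<noteq> {y, b}" using ab x y by (auto simp: doubleton_eq_iff)
  then have g12: "path_image g1 \<inter> path_image g2 \<subseteq> p ` ({a, x} \<inter> {y, b})"
    using edges_meet x y g1 g2 by simp
  show thesis
  proof (cases "x = y")
    case True
    have "{a, x} \<inter> {y, b} \<subseteq> {x}" using ab x y by auto
    then have "path_image g1 \<inter> path_image g2 \<subseteq> {pathstart g2}" using g12 True g2 by auto
    then have "arc (g1 +++ g2)" using g1 g2 True by (intro arc_join) auto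
    moreover have "path_image (g1 +++ g2) = path_image g1 \<union> path_image g2"
      using g1 g2 True by (intro path_image_join) auto
    ultimately show ?thesis using that[of "g1 +++ g2"] g1 g2 px by auto
  next
    case False
    have "{a, x} \<inter> {y, b} = {}" using ab x y False by auto
    then have g12: "path_image g1 \<inter> path_image g2 = {}" using g12 by auto
    obtain h where h: "arc h" "pathstart h = p x" "pathfinish h = p y" "path_image h \<subseteq> drawn p c E X"
      using drawn_arc[OF X x(1) y(1) False] by blast
    have "path_image h \<inter> path_image g2 \<subseteq> p ` (X \<inter> {y, b})"
      using drawn_Int_edge[OF X(2) y(2)] ab h(4) g2(4) by blast
    then have "path_image h \<inter> path_image g2 \<subseteq> {pathstart g2}" using ab g2(2) by auto
    then have hg: "arc (h +++ g2)" using h g2 by (intro arc_join) auto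
    have im: "path_image (h +++ g2) = path_image h \<union> path_image g2"
      using h g2 by (intro path_image_join) auto
    have "path_image h \<inter> path_image g1 \<subseteq> p ` (X \<inter> {a, x})"
      using drawn_Int_edge[OF X(2) x(2)] ab h(4) g1(4) by blast
    then have "path_image g1 \<inter> path_image (h +++ g2) \<subseteq> {pathstart (h +++ g2)}"
      using ab h(2) g12 im by auto
    then have "arc (g1 +++ (h +++ g2))" using g1 hg h by - (rule arc_join, auto)
    moreover have "path_image (g1 +++ (h +++ g2)) = path_image g1 \<union> (path_image h \<union> path_image g2)"
      using g1 h g2 im by (subst path_image_join) auto
    ultimately show ?thesis using that[of "g1 +++ (h +++ g2)"] g1 g2 h px by auto
  qed
qed

lemma drawn_sub: "X \<subseteq> V \<Longrightarrow> drawn p c E X \<subseteq> drawing (Graph V E) p c"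
  by (auto simp: drawn_def drawing_def)

text \<open>From a K4 minor, draw arcs \<open>P1\<close> and \<open>P2\<close> from \<open>a\<close> to \<open>b\<close> through \<open>C\<close> and through \<open>D\<close>, an arc \<open>L\<close> from \<open>a\<close> to
\<open>b\<close> within \<open>B\<close>, and an arc \<open>Q\<close> within \<open>C \<union> D\<close> between the first two. The vertex sets are disjoint, so these
arcs meet only where \<open>crossing_chords\<close> allows it.\<close>

theorem K4_free_if_outer_face:
  assumes F: "F \<in> components (- drawing (Graph V E) p c)" "\<not> bounded F" "p ` V \<subseteq> frontier F"
  shows "K4_free V E"
  unfolding K4_free_def
proof (intro notI, elim exE conjE)
  fix a b B C D
  assume sub: "B \<subseteq> V" "C \<subseteq> V" "D \<subseteq> V"
    and disj: "B \<inter> C = {}" "B \<inter> D = {}" "C \<inter> D = {}"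
    and conn: "connected_in E B" "connected_in E C" "connected_in E D"
    and ab: "a \<in> B" "b \<in> B" "a \<noteq> b"
    and CD: "touches E C D"
    and t: "touches E C {a}" "touches E C {b}" "touches E D {a}" "touches E D {b}"
  obtain x1 y1 where 1: "x1 \<in> C" "{a, x1} \<in> E" "y1 \<in> C" "{y1, b} \<in> E"
    using t(1,2) by (auto simp: touches_def insert_commute)
  obtain x2 y2 where 2: "x2 \<in> D" "{a, x2} \<in> E" "y2 \<in> D" "{y2, b} \<in> E"
    using t(3,4) by (auto simp: touches_def insert_commute)
  have abV: "a \<in> V" "b \<in> V" and abn: "a \<notin> C" "b \<notin> C" "a \<notin> D" "b \<notin> D" using ab sub disj by auto
  obtain P1 where P1: "arc P1" "pathstart P1 = p a" "pathfinish P1 = p b" "p x1 \<in> path_image P1"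
    "path_image P1 \<subseteq> drawn p c E C \<union> path_image (c {a, x1}) \<union> path_image (c {y1, b})"
    using arc_through[OF conn(2) sub(2) abn(1,2) ab(3) 1] by blast
  obtain P2 where P2: "arc P2" "pathstart P2 = p a" "pathfinish P2 = p b" "p x2 \<in> path_image P2"
    "path_image P2 \<subseteq> drawn p c E D \<union> path_image (c {a, x2}) \<union> path_image (c {y2, b})"
    using arc_through[OF conn(3) sub(3) abn(3,4) ab(3) 2] by blast
  obtain L where L: "arc L" "pathstart L = p a" "pathfinish L = p b" "path_image L \<subseteq> drawn p c E B"
    using drawn_arc[OF conn(1) sub(1) ab] by blast
  have pab: "p a \<noteq> p b" using p_inj abV ab by blast
  have ends: "p a \<in> path_image P1" "p b \<in> path_image P1" "p a \<in> path_image P2" "p b \<in> path_image P2"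
    "p a \<in> path_image L" "p b \<in> path_image L"
    using P1 P2 L pathstart_in_path_image[of P1] pathfinish_in_path_image[of P1]
      pathstart_in_path_image[of P2] pathfinish_in_path_image[of P2]
      pathstart_in_path_image[of L] pathfinish_in_path_image[of L] by simp_all
  have dCD: "drawn p c E C \<inter> drawn p c E D = {}" and dBC: "drawn p c E B \<inter> drawn p c E C = {}"
    and dBD: "drawn p c E B \<inter> drawn p c E D = {}"
    using drawn_disjoint sub disj by blast+
  have B1: "drawn p c E B \<inter> path_image (c {a, x1}) \<subseteq> p ` (B \<inter> {a, x1})"
    "drawn p c E B \<inter> path_image (c {y1, b}) \<subseteq> p ` (B \<inter> {y1, b})"
    using drawn_Int_edge[OF sub(1)] 1 disj by blast+
  have B2: "drawn p c E B \<inter> path_image (c {a, x2}) \<subseteq> p ` (B \<inter> {a, x2})"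
    "drawn p c E B \<inter> path_image (c {y2, b}) \<subseteq> p ` (B \<inter> {y2, b})"
    using drawn_Int_edge[OF sub(1)] 2 disj by blast+
  have C2: "drawn p c E C \<inter> path_image (c {a, x2}) \<subseteq> p ` (C \<inter> {a, x2})"
    "drawn p c E C \<inter> path_image (c {y2, b}) \<subseteq> p ` (C \<inter> {y2, b})"
    using drawn_Int_edge[OF sub(2)] 2 abn by blast+
  have D1: "drawn p c E D \<inter> path_image (c {a, x1}) \<subseteq> p ` (D \<inter> {a, x1})"
    "drawn p c E D \<inter> path_image (c {y1, b}) \<subseteq> p ` (D \<inter> {y1, b})"
    using drawn_Int_edge[OF sub(3)] 1 abn by blast+
  have e12: "path_image (c {a, x1}) \<inter> path_image (c {a, x2}) \<subseteq> p ` ({a, x1} \<inter> {a, x2})"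
    "path_image (c {a, x1}) \<inter> path_image (c {y2, b}) \<subseteq> p ` ({a, x1} \<inter> {y2, b})"
    "path_image (c {y1, b}) \<inter> path_image (c {a, x2}) \<subseteq> p ` ({y1, b} \<inter> {a, x2})"
    "path_image (c {y1, b}) \<inter> path_image (c {y2, b}) \<subseteq> p ` ({y1, b} \<inter> {y2, b})"
    using 1 2 abn disj ab by (intro edges_meet; auto simp: doubleton_eq_iff)+
  have x12: "x1 \<noteq> x2" "x1 \<noteq> y2" "y1 \<noteq> x2" "y1 \<noteq> y2" using 1 2 disj by blast+
  have n1: "x1 \<noteq> a" "x1 \<noteq> b" "y1 \<noteq> a" "y1 \<noteq> b" "x2 \<noteq> a" "x2 \<noteq> b" "y2 \<noteq> a" "y2 \<noteq> b"
    using 1 2 abn by blast+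
  have nB: "x1 \<notin> B" "y1 \<notin> B" "x2 \<notin> B" "y2 \<notin> B" "x2 \<notin> C" "y2 \<notin> C" "x1 \<notin> D" "y1 \<notin> D"
    using 1 2 disj by blast+
  have P1L: "path_image P1 \<inter> path_image L \<subseteq> {p a, p b}"
  proof -
    have "path_image P1 \<inter> path_image L \<subseteq> p ` (B \<inter> {a, x1}) \<union> p ` (B \<inter> {y1, b})"
      using P1(5) L(4) B1 dBC by blast
    then show ?thesis using nB by auto
  qed
  have P2L: "path_image P2 \<inter> path_image L \<subseteq> {p a, p b}"
  proof -
    have "path_image P2 \<inter> path_image L \<subseteq> p ` (B \<inter> {a, x2}) \<union> p ` (B \<inter> {y2, b})"
      using P2(5) L(4) B2 dBD by blast
    then show ?thesis using nB by auto
  qed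
  have P12: "path_image P1 \<inter> path_image P2 \<subseteq> {p a, p b}"
  proof -
    have "p ` (C \<inter> {a, x2}) = {}" "p ` (C \<inter> {y2, b}) = {}" "p ` (D \<inter> {a, x1}) = {}" "p ` (D \<inter> {y1, b}) = {}"
      "p ` ({a, x1} \<inter> {y2, b}) = {}" "p ` ({y1, b} \<inter> {a, x2}) = {}"
      "p ` ({a, x1} \<inter> {a, x2}) \<subseteq> {p a}" "p ` ({y1, b} \<inter> {y2, b}) \<subseteq> {p b}"
      using nB abn x12 n1 ab by auto
    then have z: "drawn p c E C \<inter> path_image (c {a, x2}) = {}" "drawn p c E C \<inter> path_image (c {y2, b}) = {}"
      "drawn p c E D \<inter> path_image (c {a, x1}) = {}" "drawn p c E D \<inter> path_image (c {y1, b}) = {}"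
      "path_image (c {a, x1}) \<inter> path_image (c {y2, b}) = {}"
      "path_image (c {y1, b}) \<inter> path_image (c {a, x2}) = {}"
      "path_image (c {a, x1}) \<inter> path_image (c {a, x2}) \<subseteq> {p a}"
      "path_image (c {y1, b}) \<inter> path_image (c {y2, b}) \<subseteq> {p b}"
      using C2 D1 e12 by auto
    show ?thesis
    proof
      fix w assume w: "w \<in> path_image P1 \<inter> path_image P2"
      then have "w \<in> drawn p c E C \<or> w \<in> path_image (c {a, x1}) \<or> w \<in> path_image (c {y1, b})"
        "w \<in> drawn p c E D \<or> w \<in> path_image (c {a, x2}) \<or> w \<in> path_image (c {y2, b})"
        using P1(5) P2(5) by auto
      then show "w \<in> {p a, p b}" using z dCD by (auto simp: disjoint_iff)
    qed
  qed
  have th: "theta (p a) (p b) P1 P2 L"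
    using P1 P2 L P1L P2L P12 pab ends unfolding theta_def by auto
  have connCD: "connected_in E (C \<union> D)" using conn CD by (intro connected_in_Un) auto
  have subCD: "C \<union> D \<subseteq> V" using sub by auto
  obtain g where g: "arc g" "pathstart g = p x1" "pathfinish g = p x2" "path_image g \<subseteq> drawn p c E (C \<union> D)"
    using drawn_arc[OF connCD subCD] 1 2 x12 by blast
  have BCD: "drawn p c E B \<inter> drawn p c E (C \<union> D) = {}" using disj by (intro drawn_disjoint sub subCD) auto
  have paB: "p a \<in> drawn p c E B" "p b \<in> drawn p c E B" using ab by (auto simp: drawn_def)
  then have gab: "p a \<notin> path_image g" "p b \<notin> path_image g" and gL: "path_image g \<inter> path_image L = {}"
    using g(4) BCD L(4) by auto
  have g12: "path_image g \<inter> path_image P1 \<inter> path_image P2 = {}"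
  proof -
    have "path_image g \<inter> path_image P1 \<inter> path_image P2 \<subseteq> path_image g \<inter> {p a, p b}"
      unfolding Int_assoc using P12 by (intro Int_mono) auto
    then show ?thesis using gab by auto
  qed
  obtain Q where Q: "arc Q" "path_image Q \<subseteq> path_image g"
    "path_image Q \<inter> path_image P1 = {pathstart Q}" "path_image Q \<inter> path_image P2 = {pathfinish Q}"
    by (rule arc_between_closed[OF arc_imp_path[OF g(1)] closed_path_image[OF arc_imp_path[OF P1(1)]]
        closed_path_image[OF arc_imp_path[OF P2(1)]], unfolded g(2,3), OF P1(4) P2(4) g12])
  have Qn: "p a \<notin> path_image Q" "p b \<notin> path_image Q" "path_image Q \<inter> path_image L = {}"
    using Q(2) gab gL by auto
  let ?D = "drawing (Graph V E) p c"
  have edges_D: "path_image (c e) \<subseteq> ?D" if "e \<in> E" for e using that by (auto simp: drawing_def)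
  have Q_ends: "pathstart Q \<in> path_image P1" "pathfinish Q \<in> path_image P2" using Q(3,4) by blast+
  have Q_ends': "pathstart Q \<noteq> p a" "pathstart Q \<noteq> p b" "pathfinish Q \<noteq> p a" "pathfinish Q \<noteq> p b"
    using Qn(1,2) pathstart_in_path_image[of Q] pathfinish_in_path_image[of Q] by metis+
  have x_ne: "p x1 \<noteq> p a" "p x1 \<noteq> p b" "p x2 \<noteq> p a" "p x2 \<noteq> p b"
    using p_inj[of x1 a] p_inj[of x1 b] p_inj[of x2 a] p_inj[of x2 b] abV n1 1(1) 2(1) sub by auto
  show False
  proof (rule crossing_chords[OF th Q(1) _ _ Q(3,4) Qn(3)])
    show "pathstart Q \<in> path_image P1 - {p a, p b}" "pathfinish Q \<in> path_image P2 - {p a, p b}"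
      using Q_ends Q_ends' by simp_all
    show "p a \<in> p ` V" "p b \<in> p ` V" "p x1 \<in> p ` V" "p x2 \<in> p ` V"
      using abV 1 2 sub by auto
    show "p x1 \<in> path_image P1 - {p a, p b}" "p x2 \<in> path_image P2 - {p a, p b}"
      using P1(4) P2(4) x_ne by simp_all
    have "path_image P1 \<subseteq> ?D" using P1(5) edges_D 1 drawn_sub[OF sub(2)] by blast
    moreover have "path_image P2 \<subseteq> ?D" using P2(5) edges_D 2 drawn_sub[OF sub(3)] by blast
    moreover have "path_image L \<subseteq> ?D" using L(4) drawn_sub[OF sub(1)] by blast
    moreover have "path_image Q \<subseteq> ?D" using Q(2) g(4) drawn_sub[OF subCD] by blast
    ultimately show "path_image P1 \<union> path_image P2 \<union> path_image L \<union> path_image Q \<subseteq> ?D" by blast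
    show "z \<notin> inside J" if "compact J" "J \<subseteq> ?D" "z \<in> p ` V" for J z
      using frontier_unbounded_face_not_inside[OF F(1,2)] F(3) that by blast
  qed
qed

end

theorem outerplanar_imp_K4_free:
  assumes "simple_graph G" "outerplanar G"
  shows "K4_free (verts G) (edges G)"
proof -
  obtain V E where G: "G = Graph V E" by (cases G)
  from assms obtain p c F where "plane_embedding G p c"
    "F \<in> components (- drawing G p c)" "\<not> bounded F" "p ` verts G \<subseteq> frontier F"
    by (auto simp: outerplanar_def)
  then show ?thesis using K4_free_if_outer_face assms(1) unfolding G by simp
qed

section \<open>Recursive separation by two vertices\<close>

text \<open>All components of \<open>C - {y}\<close> are adjacent to \<open>y\<close>; removing one of them leaves the others connected through \<open>y\<close>.\<close>

lemma connected_in_Diff_component: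
  assumes C: "connected_in E C" and y: "y \<in> C" and M: "M \<subseteq> C - {y}" "\<not> touches E M (C - {y} - M)"
  shows "connected_in E (C - M)"
  unfolding connected_in_def
proof (intro allI impI)
  fix A assume A: "A \<noteq> {} \<and> A \<subset> C - M"
  have *: "touches E T (C - M - T)" if T: "T \<noteq> {}" "T \<subseteq> C - M" "y \<notin> T" for T
  proof -
    have "touches E T (C - T)" using T y by (intro connected_inD[OF C]) auto
    then obtain t u where tu: "t \<in> T" "u \<in> C" "u \<notin> T" "{t, u} \<in> E" by (auto simp: touches_def)
    have "u \<notin> M"
    proof
      assume "u \<in> M"
      moreover have "{u, t} \<in> E" "t \<in> C - {y} - M" using tu T by (auto simp: insert_commute)
      ultimately have "touches E M (C - {y} - M)" unfolding touches_def by blast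
      then show False using M by blast
    qed
    then show ?thesis using tu by (auto simp: touches_def)
  qed
  show "touches E A (C - M - A)"
  proof (cases "y \<in> A")
    case False
    then show ?thesis using * A by blast
  next
    case True
    have "C - M - (C - M - A) = A" using A by blast
    then show ?thesis using *[of "C - M - A"] A True touches_sym by (metis Diff_eq_empty_iff Diff_iff Diff_subset psubsetE subset_antisym)
  qed
qed

lemma K4_freeD:
  assumes "K4_free V E" "B \<subseteq> V" "C \<subseteq> V" "D \<subseteq> V" "B \<inter> C = {}" "B \<inter> D = {}" "C \<inter> D = {}"
    "connected_in E B" "connected_in E C" "connected_in E D" "a \<in> B" "b \<in> B" "a \<noteq> b"
    "touches E C D" "touches E C {a}" "touches E C {b}" "touches E D {a}" "touches E D {b}"
  shows False
  using assms(1) unfolding K4_free_def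
  by (elim notE) (intro exI conjI, (rule assms(2-))+)

lemma touches_Un: "touches E (X \<union> Y) Z \<longleftrightarrow> touches E X Z \<or> touches E Y Z"
  by (auto simp: touches_def)

lemma touches_nonempty: "touches E X Y \<Longrightarrow> X \<noteq> {} \<and> Y \<noteq> {}"
  by (auto simp: touches_def)

text \<open>If no single vertex of \<open>C\<close> separates \<open>a\<close> from \<open>b\<close> within \<open>C\<close>, then \<open>C\<close> falls into two connected parts that both
touch \<open>a\<close> and \<open>b\<close>. This plays the role of Menger's theorem for two paths.

Choose a connected \<open>D\<close> that touches \<open>a\<close>, is as large as possible, and whose complement \<open>C1\<close> in \<open>C\<close> is connected
and touches both \<open>a\<close> and \<open>b\<close>. Suppose that \<open>D\<close> does not touch \<open>b\<close>. By maximality each vertex \<open>x\<close> of \<open>C1\<close> next to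
\<open>D\<close> separates \<open>a\<close> from \<open>b\<close> within \<open>C1\<close>. As \<open>x\<close> does not do so within \<open>C\<close>, there is a detour through \<open>D\<close>, and
it returns to \<open>C1\<close> at another vertex \<open>x'\<close> next to \<open>D\<close>, beyond \<open>x\<close> as seen from \<open>a\<close>. Hence no \<open>x\<close> is the one
closest to \<open>b\<close>, which is absurd.\<close>

lemma connected_bipartition:
  assumes fin: "finite C" and C: "connected_in E C"
    and ta: "touches E C {a}" and tb: "touches E C {b}"
    and no: "\<And>y. y \<in> C \<Longrightarrow> \<exists>K \<subseteq> C - {y}. connected_in E K \<and> touches E K {a} \<and> touches E K {b}"
  obtains C1 C2 where "C1 \<union> C2 = C" "C1 \<inter> C2 = {}" "connected_in E C1" "connected_in E C2"
    "touches E C1 C2" "touches E C1 {a}" "touches E C1 {b}" "touches E C2 {a}" "touches E C2 {b}"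
proof -
  define \<P> where "\<P> = {D. D \<subseteq> C \<and> connected_in E D \<and> connected_in E (C - D) \<and>
    touches E D {a} \<and> touches E (C - D) {a} \<and> touches E (C - D) {b}}"
  have "\<P> \<subseteq> Pow C" by (auto simp: \<P>_def)
  then have "finite \<P>" using fin by (metis finite_Pow_iff finite_subset)
  moreover have "\<P> \<noteq> {}"
  proof -
    obtain y where y: "y \<in> C" "{y, a} \<in> E" using ta by (auto simp: touches_def)
    obtain K where K: "K \<subseteq> C - {y}" "connected_in E K" "touches E K {a}" "touches E K {b}"
      using no[OF y(1)] by blast
    obtain M where M: "K \<subseteq> M" "M \<subseteq> C - {y}" "connected_in E M" "\<not> touches E M (C - {y} - M)"
      using connected_component_exists[of "C - {y}" E K] K fin touches_nonempty[OF K(3)] by auto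
    have "C - (C - M) = M" using M by blast
    moreover have "connected_in E (C - M)" using connected_in_Diff_component[OF C y(1) M(2,4)] .
    moreover have "touches E (C - M) {a}" using y M by (auto simp: touches_def)
    ultimately have "C - M \<in> \<P>"
      using M K touches_mono[OF K(3) M(1)] touches_mono[OF K(4) M(1)] by (auto simp: \<P>_def)
    then show ?thesis by blast
  qed
  ultimately obtain D where D: "D \<in> \<P>" and max: "\<And>D'. D' \<in> \<P> \<Longrightarrow> D \<subseteq> D' \<Longrightarrow> D = D'"
    using finite_has_maximal by metis
  define C1 where "C1 = C - D"
  have DC: "D \<subseteq> C" "connected_in E D" "connected_in E C1" "touches E D {a}" "touches E C1 {a}" "touches E C1 {b}"
    using D by (auto simp: \<P>_def C1_def)
  have C1D: "touches E D C1"
    unfolding C1_def using DC touches_nonempty C1_def by (intro connected_inD[OF C]) blast+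
  have finC1: "finite C1" using fin by (simp add: C1_def)
  have "touches E D {b}"
  proof (rule ccontr)
    assume nb: "\<not> touches E D {b}"
    \<comment> \<open>\<open>B x\<close> is the part of \<open>C1\<close> beyond \<open>x\<close>, on the side of \<open>b\<close>.\<close>
    define T where "T = {x \<in> C1. touches E D {x}}"
    define B where "B x = {z. \<exists>K \<subseteq> C1 - {x}. connected_in E K \<and> z \<in> K \<and> touches E K {b}}" for x
    \<comment> \<open>A component of \<open>C1 - {x}\<close> touching \<open>a\<close> and \<open>b\<close> could replace \<open>C1\<close>, with \<open>x\<close> and all else moved to \<open>D\<close>.\<close>
    have T1: False if x: "x \<in> T" and K: "K \<subseteq> C1 - {x}" "connected_in E K" "touches E K {a}" "touches E K {b}" for x K
    proof -
      have xC1: "x \<in> C1" and xD: "touches E D {x}" using x by (auto simp: T_def)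
      obtain M where M: "K \<subseteq> M" "M \<subseteq> C1 - {x}" "connected_in E M" "\<not> touches E M (C1 - {x} - M)"
        using connected_component_exists[of "C1 - {x}" E K] K finC1 touches_nonempty[OF K(3)] by auto
      have "connected_in E (C1 - M)" using connected_in_Diff_component[OF DC(3) xC1 M(2,4)] .
      moreover have "touches E D (C1 - M)" by (rule touches_mono[OF xD]) (use xC1 M in auto)
      ultimately have "connected_in E (D \<union> (C1 - M))" using DC by (intro connected_in_Un) auto
      moreover have "D \<union> (C1 - M) = C - M" "C - (C - M) = M" using M DC by (auto simp: C1_def)
      moreover have "touches E (C - M) {a}" by (rule touches_mono[OF DC(4)]) (use M DC in \<open>auto simp: C1_def\<close>)
      ultimately have "C - M \<in> \<P>"
        using M touches_mono[OF K(3) M(1)] touches_mono[OF K(4) M(1)] by (auto simp: \<P>_def)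
      moreover have "D \<subseteq> C - M" "x \<in> C - M" "x \<notin> D" using M DC xC1 by (auto simp: C1_def)
      ultimately show False using max by blast
    qed
    \<comment> \<open>On the detour, \<open>x'\<close> is the vertex at which the last piece within \<open>C1\<close> begins.\<close>
    have T2: "\<exists>x'. x' \<in> T \<and> x' \<in> B x" if x: "x \<in> T" for x
    proof -
      have "x \<in> C" using x by (auto simp: T_def C1_def)
      then obtain K where K: "K \<subseteq> C - {x}" "connected_in E K" "touches E K {a}" "touches E K {b}"
        using no by blast
      have KD: "\<not> K \<subseteq> C1"
        using T1[OF x, of K] K by blast
      obtain k where k: "k \<in> K" "{k, b} \<in> E" using K(4) by (auto simp: touches_def)
      have kC1: "k \<in> C1" using k nb K(1) by (auto simp: touches_def C1_def)
      obtain M where M: "{k} \<subseteq> M" "M \<subseteq> K \<inter> C1" "connected_in E M" "\<not> touches E M (K \<inter> C1 - M)"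
        by (rule connected_component_exists[of "K \<inter> C1" E "{k}"])
          (use k kC1 finC1 in \<open>auto simp: connected_in_singleton\<close>)
      have "touches E M (K - M)" using M KD by (intro connected_inD[OF K(2)]) auto
      then obtain m u where mu: "m \<in> M" "u \<in> K" "u \<notin> M" "{m, u} \<in> E" by (auto simp: touches_def)
      have "u \<notin> C1" using mu M(4) by (auto simp: touches_def)
      then have "u \<in> D" using mu K(1) by (auto simp: C1_def)
      then have "touches E D {m}" using mu by (auto simp: touches_def insert_commute)
      then have "m \<in> T" using mu M by (auto simp: T_def)
      moreover have "M \<subseteq> C1 - {x}" "touches E M {b}" using M(1,2) K(1) k(2) by (auto simp: touches_def)
      then have "m \<in> B x" using M(3) mu(1) unfolding B_def by blast
      ultimately show ?thesis by blast
    qed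
    have T3: "B x' \<subset> B x" if x: "x \<in> T" "x' \<in> T" "x' \<in> B x" for x x'
    proof -
      obtain K' where K': "K' \<subseteq> C1 - {x}" "connected_in E K'" "x' \<in> K'" "touches E K' {b}"
        using x by (auto simp: B_def)
      \<comment> \<open>Starting from a neighbour of \<open>a\<close>, whichever of \<open>x\<close> and \<open>x'\<close> is reached first leads on to \<open>b\<close> past the other one.\<close>
      have avoid: "x \<notin> K" if K: "K \<subseteq> C1 - {x'}" "connected_in E K" "touches E K {b}" for K
      proof
        assume xK: "x \<in> K"
        obtain a0 where a0: "a0 \<in> C1" "{a0, a} \<in> E" using DC(5) by (auto simp: touches_def)
        consider "a0 = x" | "a0 = x'" | "a0 \<in> C1 - {x, x'}" using a0 by blast
        then show False
        proof cases
          case 1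
          then have "touches E K {a}" using a0 xK by (auto simp: touches_def)
          then show False using T1[OF x(2) K(1,2) _ K(3)] by blast
        next
          case 2
          then have "touches E K' {a}" using a0 K' by (auto simp: touches_def)
          then show False using T1[OF x(1) K'(1,2) _ K'(4)] by blast
        next
          case 3
          obtain M where M: "{a0} \<subseteq> M" "M \<subseteq> C1 - {x, x'}" "connected_in E M" "\<not> touches E M (C1 - {x, x'} - M)"
            by (rule connected_component_exists[of "C1 - {x, x'}" E "{a0}"])
              (use 3 finC1 in \<open>auto simp: connected_in_singleton\<close>)
          have Ma: "touches E M {a}" using M a0 by (auto simp: touches_def)
          have "touches E M (C1 - M)" using M x by (intro connected_inD[OF DC(3)]) (auto simp: T_def)
          then obtain m u where mu: "m \<in> M" "u \<in> C1" "u \<notin> M" "{m, u} \<in> E" by (auto simp: touches_def)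
          have "u = x \<or> u = x'" using mu M(4) by (auto simp: touches_def)
          then show False
          proof
            assume "u = x"
            then have "touches E M K" using mu xK by (auto simp: touches_def)
            then have "connected_in E (M \<union> K)" using M K by (intro connected_in_Un) auto
            then show False using T1[OF x(2), of "M \<union> K"] Ma M K by (auto simp: touches_Un)
          next
            assume "u = x'"
            then have "touches E M K'" using mu K' by (auto simp: touches_def)
            then have "connected_in E (M \<union> K')" using M K' by (intro connected_in_Un) auto
            then show False using T1[OF x(1), of "M \<union> K'"] Ma M K' by (auto simp: touches_Un)
          qed
        qed
      qed
      have "B x' \<subseteq> B x"
      proof
        fix z assume "z \<in> B x'"
        then obtain K where K: "K \<subseteq> C1 - {x'}" "connected_in E K" "z \<in> K" "touches E K {b}" by (auto simp: B_def)
        then have "K \<subseteq> C1 - {x}" using avoid by blast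
        then show "z \<in> B x" using K by (auto simp: B_def)
      qed
      moreover have "x' \<notin> B x'" by (auto simp: B_def)
      ultimately show ?thesis using x by blast
    qed
    have "T \<noteq> {}" using C1D by (auto simp: T_def touches_def)
    then obtain x where x: "x \<in> T" "\<And>x'. x' \<in> T \<Longrightarrow> card (B x) \<le> card (B x')"
      using ex_has_least_nat[of "\<lambda>x. x \<in> T" _ "\<lambda>x. card (B x)"] by blast
    obtain x' where x': "x' \<in> T" "x' \<in> B x" using T2[OF x(1)] by blast
    have "B x \<subseteq> C1" by (auto simp: B_def)
    then have "finite (B x)" using finC1 finite_subset by blast
    then have "card (B x') < card (B x)" using T3[OF x(1) x'] by (rule psubset_card_mono)
    then show False using x(2)[OF x'(1)] by simp
  qed
  moreover have "C1 \<union> D = C" "C1 \<inter> D = {}" using DC(1) by (auto simp: C1_def)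
  moreover have "touches E C1 D" using C1D touches_sym by blast
  ultimately show thesis using that[of C1 D] DC by blast
qed

definition neighbours :: "'a set set \<Rightarrow> 'a set \<Rightarrow> 'a set" where
  "neighbours E C = {x. x \<notin> C \<and> touches E C {x}}"

locale finite_graph =
  fixes V :: "'a set" and E :: "'a set set"
  assumes finite_V: "finite V" and edge_sub: "e \<in> E \<Longrightarrow> e \<subseteq> V" and edge_card: "e \<in> E \<Longrightarrow> card e = 2"
begin

text \<open>The last condition says that the neighbours of \<open>C\<close> are connected to each other outside of \<open>C\<close>. When \<open>C\<close> has two
neighbours, this provides the set \<open>B\<close> of a K4 minor whose other branch sets are found within \<open>C\<close>.\<close>

definition attached :: "'a set \<Rightarrow> bool" where
  "attached C \<longleftrightarrow> C \<subseteq> V \<and> C \<noteq> {} \<and> connected_in E C \<and> card (neighbours E C) \<le> 2 \<and>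
     (\<exists>B \<subseteq> V. B \<inter> C = {} \<and> connected_in E B \<and> neighbours E C \<subseteq> B)"

lemma finite_E: "finite E"
  using finite_subset[of E "Pow V"] edge_sub finite_V by auto

lemma neighbours_sub: "neighbours E C \<subseteq> V"
  using edge_sub by (auto simp: neighbours_def touches_def)

lemma finite_neighbours: "finite (neighbours E C)"
  using neighbours_sub finite_V finite_subset by blast

lemma attached_finite: "attached C \<Longrightarrow> finite C"
  using finite_V finite_subset unfolding attached_def by blast

lemma edge_elim:
  assumes "e \<in> E" "x \<in> e"
  obtains y where "e = {x, y}" "x \<noteq> y" "y \<in> V" "x \<in> V"
  using edge_card[OF assms(1)] edge_sub[OF assms(1)] assms(2)
  by (auto simp: card_2_iff)

lemma attached_component:
  assumes "K \<noteq> {}" "connected_in E K" "K \<subseteq> V"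
  obtains C where "attached C" "K \<subseteq> C" "neighbours E C = {}"
proof -
  obtain M where M: "K \<subseteq> M" "M \<subseteq> V" "connected_in E M" "\<not> touches E M (V - M)"
    using connected_component_exists[OF finite_V assms(2,1,3)] by blast
  have "neighbours E M = {}"
  proof (rule ccontr)
    assume "neighbours E M \<noteq> {}"
    then obtain x where x: "x \<notin> M" "touches E M {x}" by (auto simp: neighbours_def)
    then have "x \<in> V - M" using neighbours_sub[of M] by (auto simp: neighbours_def)
    then show False using M(4) touches_mono[OF x(2)] by blast
  qed
  moreover from this have "attached M"
    using M assms(1) by (auto simp: attached_def connected_in_def)
  ultimately show thesis using that M by blast
qed

text \<open>Otherwise \<open>connected_bipartition\<close> splits \<open>C\<close> into two branch sets that complete a K4 minor.\<close>

lemma attached_separating_vertex: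
  assumes K4: "K4_free V E" and C: "attached C" and ab: "neighbours E C = {a, b}" "a \<noteq> b"
  obtains y where "y \<in> C" "\<And>K. K \<subseteq> C - {y} \<Longrightarrow> connected_in E K \<Longrightarrow> touches E K {a} \<Longrightarrow> touches E K {b} \<Longrightarrow> False"
proof -
  have CV: "C \<subseteq> V" "connected_in E C" using C by (auto simp: attached_def)
  have "a \<in> neighbours E C" "b \<in> neighbours E C" using ab by auto
  then have t: "touches E C {a}" "touches E C {b}" by (auto simp: neighbours_def)
  obtain B where B: "B \<subseteq> V" "B \<inter> C = {}" "connected_in E B" "a \<in> B" "b \<in> B"
    using C ab(1) by (auto simp: attached_def)
  have "\<exists>y\<in>C. \<not> (\<exists>K \<subseteq> C - {y}. connected_in E K \<and> touches E K {a} \<and> touches E K {b})"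
  proof (rule ccontr)
    assume "\<not> ?thesis"
    then have no: "\<exists>K \<subseteq> C - {y}. connected_in E K \<and> touches E K {a} \<and> touches E K {b}" if "y \<in> C" for y
      using that by blast
    obtain C1 C2 where 12: "C1 \<union> C2 = C" "C1 \<inter> C2 = {}" "connected_in E C1" "connected_in E C2"
      "touches E C1 C2" "touches E C1 {a}" "touches E C1 {b}" "touches E C2 {a}" "touches E C2 {b}"
      using connected_bipartition[OF finite_subset[OF CV(1) finite_V] CV(2) t no] by blast
    have "C1 \<subseteq> V" "C2 \<subseteq> V" "B \<inter> C1 = {}" "B \<inter> C2 = {}" using 12(1) CV(1) B(2) by auto
    from K4_freeD[OF K4 B(1) this(1,2) this(3,4) 12(2) B(3) 12(3,4) B(4,5) ab(2) 12(5-9)]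
    show False .
  qed
  then show thesis using that by blast
qed

text \<open>Choose \<open>y\<close> as a vertex separating the two neighbours of \<open>C\<close>, or as a vertex adjacent to the only neighbour, if
there is one. A component \<open>M\<close> of \<open>C - {y}\<close> then has at most one of the neighbours of \<open>C\<close> as a neighbour, besides
\<open>y\<close>. The remainder \<open>C - M\<close> is connected, contains \<open>y\<close>, and is adjacent to some neighbour of \<open>C\<close> if there is any, so
it can be added to the connected set outside of \<open>C\<close> to connect the neighbours of \<open>M\<close> outside of \<open>M\<close>.\<close>

lemma attached_split:
  assumes K4: "K4_free V E" and C: "attached C"
  shows "\<exists>y\<in>C. \<forall>K. K \<noteq> {} \<and> connected_in E K \<and> K \<subseteq> C - {y} \<longrightarrow>
    (\<exists>C'. attached C' \<and> K \<subseteq> C' \<and> C' \<subseteq> C - {y})"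
proof -
  have CV: "C \<subseteq> V" "C \<noteq> {}" "connected_in E C" "card (neighbours E C) \<le> 2" using C by (auto simp: attached_def)
  have nbC: "touches E C {x}" "x \<notin> C" if "x \<in> neighbours E C" for x using that by (auto simp: neighbours_def)
  have split: "touches E M {x} \<or> touches E (C - M) {x}" if "x \<in> neighbours E C" "M \<subseteq> C" for x M
    using nbC[OF that(1)] touches_Un[of E M "C - M" "{x}"] that(2) by (simp add: Un_absorb1)
  obtain y where y: "y \<in> C" and ym: "\<And>M. M \<subseteq> C - {y} \<Longrightarrow> connected_in E M \<Longrightarrow>
      card (neighbours E C \<inter> neighbours E M) \<le> 1 \<and>
      (neighbours E C = {} \<or> (\<exists>x\<in>neighbours E C. touches E (C - M) {x}))"
  proof -
    consider "neighbours E C = {}" | a where "neighbours E C = {a}" | a b where "neighbours E C = {a, b}" "a \<noteq> b"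
      using CV(4) finite_neighbours[of C]
      by (metis card_0_eq card_1_singletonE card_2_iff le_Suc_eq le_zero_eq numeral_2_eq_2 One_nat_def)
    then show thesis
    proof cases
      case 1
      then show ?thesis using that CV(2) by (metis Int_empty_left card.empty ex_in_conv zero_le)
    next
      case 2
      then obtain y where y: "y \<in> C" "{y, a} \<in> E" using nbC[of a] by (auto simp: touches_def)
      show ?thesis
      proof (rule that[OF y(1)])
        fix M assume M: "M \<subseteq> C - {y}"
        have "card (neighbours E C \<inter> neighbours E M) \<le> card {a}" using 2 by (intro card_mono) auto
        moreover have "touches E (C - M) {a}" using y M by (auto simp: touches_def)
        ultimately show "card (neighbours E C \<inter> neighbours E M) \<le> 1 \<and>
          (neighbours E C = {} \<or> (\<exists>x\<in>neighbours E C. touches E (C - M) {x}))" using 2 by simp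
      qed
    next
      case 3
      obtain y where y: "y \<in> C" "\<And>K. K \<subseteq> C - {y} \<Longrightarrow> connected_in E K \<Longrightarrow> touches E K {a} \<Longrightarrow> touches E K {b} \<Longrightarrow> False"
        using attached_separating_vertex[OF K4 C 3] by blast
      show ?thesis
      proof (rule that[OF y(1)])
        fix M assume M: "M \<subseteq> C - {y}" "connected_in E M"
        have nab: "\<not> touches E M {a} \<or> \<not> touches E M {b}" using y(2)[OF M] by blast
        then have "neighbours E C \<inter> neighbours E M \<subseteq> {a} \<or> neighbours E C \<inter> neighbours E M \<subseteq> {b}"
          using 3 by (auto simp: neighbours_def)
        then have "card (neighbours E C \<inter> neighbours E M) \<le> 1"
          by (metis card.empty card_insert_disjoint card_mono empty_iff finite.intros One_nat_def)
        moreover have "touches E (C - M) {a} \<or> touches E (C - M) {b}"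
          using nab split[of a M] split[of b M] M 3 by auto
        ultimately show "card (neighbours E C \<inter> neighbours E M) \<le> 1 \<and>
          (neighbours E C = {} \<or> (\<exists>x\<in>neighbours E C. touches E (C - M) {x}))" using 3 by auto
      qed
    qed
  qed
  show ?thesis
  proof (intro bexI[OF _ y] allI impI, elim conjE)
    fix K assume K: "K \<noteq> {}" "connected_in E K" "K \<subseteq> C - {y}"
    have "finite (C - {y})" using CV finite_V finite_subset by blast
    then obtain M where M: "K \<subseteq> M" "M \<subseteq> C - {y}" "connected_in E M" "\<not> touches E M (C - {y} - M)"
      using connected_component_exists K by metis
    note P = ym[OF M(2,3)]
    have nbM: "neighbours E M \<subseteq> insert y (neighbours E C \<inter> neighbours E M)"
    proof
      fix z assume z: "z \<in> neighbours E M"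
      then have z': "z \<notin> M" "touches E M {z}" by (auto simp: neighbours_def)
      show "z \<in> insert y (neighbours E C \<inter> neighbours E M)"
      proof (cases "z \<in> C")
        case True
        then have "z = y" using z' M(4) touches_mono[OF z'(2), of M "C - {y} - M"] by blast
        then show ?thesis by blast
      next
        case False
        then have "z \<in> neighbours E C" using touches_mono[OF z'(2), of C "{z}"] M(2) by (auto simp: neighbours_def)
        then show ?thesis using z by blast
      qed
    qed
    have "card (neighbours E M) \<le> card (insert y (neighbours E C \<inter> neighbours E M))"
      using nbM finite_neighbours by (intro card_mono) auto
    also have "\<dots> \<le> 2" using P finite_neighbours[of C] by (simp add: card_insert_if)
    finally have card2: "card (neighbours E M) \<le> 2" .
    have connCM: "connected_in E (C - M)" using connected_in_Diff_component[OF CV(3) y M(2,4)] .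
    have "\<exists>B \<subseteq> V. B \<inter> M = {} \<and> connected_in E B \<and> neighbours E M \<subseteq> B"
    proof (cases "neighbours E C = {}")
      case True
      then have "neighbours E M \<subseteq> C - M" using nbM y M(2) by blast
      moreover have "C - M \<subseteq> V" "(C - M) \<inter> M = {}" using CV by auto
      ultimately show ?thesis using connCM by blast
    next
      case False
      then obtain x where x: "x \<in> neighbours E C" "touches E (C - M) {x}" using P by blast
      obtain B where B: "B \<subseteq> V" "B \<inter> C = {}" "connected_in E B" "neighbours E C \<subseteq> B"
        using C by (auto simp: attached_def)
      have "touches E (C - M) B" by (rule touches_mono[OF x(2)]) (use x(1) B(4) in auto)
      then have "connected_in E ((C - M) \<union> B)" using connCM B by (intro connected_in_Un) auto
      moreover have "neighbours E M \<subseteq> (C - M) \<union> B" using nbM B(4) y M(2) by blast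
      moreover have "(C - M) \<union> B \<subseteq> V" "((C - M) \<union> B) \<inter> M = {}" using CV B M(2) by auto
      ultimately show ?thesis by blast
    qed
    then have "attached M" using card2 M K CV by (auto simp: attached_def)
    then show "\<exists>C'. attached C' \<and> K \<subseteq> C' \<and> C' \<subseteq> C - {y}" using M by blast
  qed
qed

text \<open>A minimal attached set \<open>C\<close> that meets \<open>X\<close> can meet it only in its splitting vertex \<open>y\<close>, so all neighbours of \<open>y\<close> in
\<open>X\<close> are among the at most two neighbours of \<open>C\<close>.\<close>

lemma exists_low_degree:
  assumes K4: "K4_free V E" and X: "X \<subseteq> V" "X \<noteq> {}"
  obtains y where "y \<in> X" "card {e \<in> E. y \<in> e \<and> e \<subseteq> X} \<le> 2"
proof -
  obtain x where x: "x \<in> X" using X by blast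
  have "{x} \<noteq> {}" "{x} \<subseteq> V" using x X by auto
  then obtain C0 where "attached C0" "{x} \<subseteq> C0"
    using attached_component[OF _ connected_in_singleton] by metis
  then have "attached C0 \<and> C0 \<inter> X \<noteq> {}" using x by blast
  then obtain C where C: "attached C" "C \<inter> X \<noteq> {}"
    and min: "\<And>C'. attached C' \<and> C' \<inter> X \<noteq> {} \<Longrightarrow> card C \<le> card C'"
    using ex_has_least_nat[of "\<lambda>C. attached C \<and> C \<inter> X \<noteq> {}" C0 card] by blast
  obtain y where y: "y \<in> C"
    and ys: "\<forall>K. K \<noteq> {} \<and> connected_in E K \<and> K \<subseteq> C - {y} \<longrightarrow>
      (\<exists>C'. attached C' \<and> K \<subseteq> C' \<and> C' \<subseteq> C - {y})"
    using attached_split[OF K4 C(1)] by blast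
  have finC: "finite C" using C(1) by (rule attached_finite)
  have CX: "C \<inter> X \<subseteq> {y}"
  proof (rule ccontr)
    assume "\<not> C \<inter> X \<subseteq> {y}"
    then obtain z where z: "z \<in> C" "z \<in> X" "z \<noteq> y" by blast
    then have "\<exists>C'. attached C' \<and> {z} \<subseteq> C' \<and> C' \<subseteq> C - {y}"
      by (intro ys[rule_format] conjI connected_in_singleton) auto
    then obtain C' where C': "attached C'" "{z} \<subseteq> C'" "C' \<subseteq> C - {y}" by blast
    have "card C' < card C" using C'(3) y finC by (intro psubset_card_mono) auto
    then show False using min[of C'] C'(1,2) z(2) by auto
  qed
  then have yX: "y \<in> X" using C(2) by blast
  have "{e \<in> E. y \<in> e \<and> e \<subseteq> X} \<subseteq> (\<lambda>z. {y, z}) ` neighbours E C"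
  proof
    fix e assume e: "e \<in> {e \<in> E. y \<in> e \<and> e \<subseteq> X}"
    then obtain z where z: "e = {y, z}" "y \<noteq> z" using edge_elim[of e y] by blast
    then have "z \<notin> C" using CX e by blast
    then have "z \<in> neighbours E C" using y e z by (auto simp: neighbours_def touches_def)
    then show "e \<in> (\<lambda>z. {y, z}) ` neighbours E C" using z by blast
  qed
  then have "card {e \<in> E. y \<in> e \<and> e \<subseteq> X} \<le> card (neighbours E C)"
    using finite_neighbours[of C] by (meson card_image_le card_mono finite_imageI le_trans)
  also have "\<dots> \<le> 2" using C(1) by (auto simp: attached_def)
  finally show thesis using that yX by blast
qed

lemma card_edges_le:
  assumes K4: "K4_free V E" and X: "X \<subseteq> V"
  shows "card {e \<in> E. e \<subseteq> X} \<le> 2 * card X"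
proof -
  have "finite X" using X finite_V finite_subset by blast
  then show ?thesis using X
  proof (induction X rule: finite_psubset_induct)
    case (psubset X)
    show ?case
    proof (cases "X = {}")
      case True
      have "{e \<in> E. e \<subseteq> X} = {}" using True edge_card by fastforce
      then show ?thesis by (metis card.empty zero_le)
    next
      case False
      obtain y where y: "y \<in> X" "card {e \<in> E. y \<in> e \<and> e \<subseteq> X} \<le> 2"
        by (rule exists_low_degree[OF K4 psubset.prems False])
      have "{e \<in> E. e \<subseteq> X} = {e \<in> E. e \<subseteq> X - {y}} \<union> {e \<in> E. y \<in> e \<and> e \<subseteq> X}" by blast
      then have "card {e \<in> E. e \<subseteq> X} \<le> card {e \<in> E. e \<subseteq> X - {y}} + card {e \<in> E. y \<in> e \<and> e \<subseteq> X}"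
        by (simp only: card_Un_le)
      moreover have "card {e \<in> E. e \<subseteq> X - {y}} \<le> 2 * card (X - {y})"
        using y psubset.prems by (intro psubset.IH) auto
      moreover have "card X = Suc (card (X - {y}))" using y psubset.hyps by (metis card.remove)
      ultimately show ?thesis using y by linarith
    qed
  qed
qed

end

section \<open>Families of eggs with large hitting sets and large cuts\<close>

text \<open>The number \<open>s\<close> is only a lower bound for hitting sets and cuts. This leaves room to lower it by \<open>k\<close> when \<open>k\<close> edges
are deleted.\<close>

locale egg_family = finite_graph V E for V :: "'a set" and E +
  fixes S :: "'a set set" and s :: nat
  assumes egg: "h \<in> S \<Longrightarrow> h \<subseteq> V \<and> h \<noteq> {} \<and> connected_in E h"
    and hit: "X \<subseteq> V \<Longrightarrow> (\<And>h. h \<in> S \<Longrightarrow> h \<inter> X \<noteq> {}) \<Longrightarrow> s \<le> card X"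
    and cut: "A \<subseteq> V \<Longrightarrow> h \<in> S \<Longrightarrow> h \<subseteq> A \<Longrightarrow> h' \<in> S \<Longrightarrow> h' \<subseteq> V - A \<Longrightarrow>
      s \<le> card {e \<in> E. e \<inter> A \<noteq> {} \<and> \<not> e \<subseteq> A}"
    and K4_free: "K4_free V E"
begin

definition deg :: "'a \<Rightarrow> nat" where
  "deg v = card {e \<in> E. v \<in> e}"

definition exits :: "'a set \<Rightarrow> 'a set \<Rightarrow> 'a set set" where
  "exits Q Z = {e \<in> E. e \<inter> Q \<noteq> {} \<and> \<not> e \<subseteq> Q \<union> Z}"

text \<open>Cut off \<open>Q\<close> together with those vertices of \<open>Z\<close> that have at least as many edges to \<open>Q\<close> as elsewhere. A vertex \<open>z\<close> of
\<open>Z\<close> then contributes the smaller of these two numbers to the cut, which is at most half its degree; the other edges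
of the cut leave \<open>Q\<close> without ending in \<open>Z\<close>.\<close>

lemma separated_eggs:
  assumes Q: "Q \<subseteq> V" and Z: "Z \<subseteq> V" "Q \<inter> Z = {}"
    and h: "h \<in> S" "h \<subseteq> Q" and h': "h' \<in> S" "h' \<subseteq> V - Q - Z"
  shows "s \<le> card (exits Q Z) + (\<Sum>z\<in>Z. deg z div 2)"
proof -
  define inn where "inn z = {e \<in> E. z \<in> e \<and> e \<inter> Q \<noteq> {}}" for z
  define out where "out z = {e \<in> E. z \<in> e \<and> e \<inter> Q = {}}" for z
  define T where "T = {z \<in> Z. card (out z) \<le> card (inn z)}"
  define paid where "paid z = (if z \<in> T then out z else inn z)" for z
  have finZ: "finite Z" using Z finite_V finite_subset by blast
  have fin: "finite (paid z)" for z using finite_E by (auto simp: paid_def inn_def out_def)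
  have half: "card (paid z) \<le> deg z div 2" if "z \<in> Z" for z
  proof -
    have "{e \<in> E. z \<in> e} = inn z \<union> out z" "inn z \<inter> out z = {}" by (auto simp: inn_def out_def)
    then have "deg z = card (inn z) + card (out z)"
      using finite_E by (simp add: deg_def card_Un_disjoint inn_def out_def)
    then show ?thesis using that by (auto simp: paid_def T_def)
  qed
  have "{e \<in> E. e \<inter> (Q \<union> T) \<noteq> {} \<and> \<not> e \<subseteq> Q \<union> T} \<subseteq> exits Q Z \<union> (\<Union>z\<in>Z. paid z)"
  proof
    fix e assume e: "e \<in> {e \<in> E. e \<inter> (Q \<union> T) \<noteq> {} \<and> \<not> e \<subseteq> Q \<union> T}"
    then obtain x where x: "x \<in> e" "x \<in> Q \<union> T" by blast
    have "e \<in> E" using e by blast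
    then obtain y where y: "e = {x, y}" using edge_elim x(1) by metis
    then have yn: "y \<notin> Q \<union> T" using e x by auto
    show "e \<in> exits Q Z \<union> (\<Union>z\<in>Z. paid z)"
    proof (cases "x \<in> Q")
      case True
      show ?thesis
      proof (cases "y \<in> Z")
        case yZ: True
        then have "e \<in> paid y" using True y yn e by (auto simp: paid_def inn_def)
        then show ?thesis using yZ by blast
      next
        case False
        then show ?thesis using True y yn e by (auto simp: exits_def)
      qed
    next
      case False
      then have xT: "x \<in> T" using x by blast
      then have "e \<in> paid x" using y yn False e by (auto simp: paid_def out_def)
      then show ?thesis using xT by (auto simp: T_def)
    qed
  qed
  moreover have "finite (exits Q Z \<union> (\<Union>z\<in>Z. paid z))"
    using finZ fin finite_E by (auto simp: exits_def)
  ultimately have "card {e \<in> E. e \<inter> (Q \<union> T) \<noteq> {} \<and> \<not> e \<subseteq> Q \<union> T} \<le> card (exits Q Z \<union> (\<Union>z\<in>Z. paid z))"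
    by (rule card_mono[rotated])
  also have "\<dots> \<le> card (exits Q Z) + card (\<Union>z\<in>Z. paid z)" by (rule card_Un_le)
  also have "card (\<Union>z\<in>Z. paid z) \<le> (\<Sum>z\<in>Z. card (paid z))" by (rule card_UN_le[OF finZ])
  also have "\<dots> \<le> (\<Sum>z\<in>Z. deg z div 2)" by (rule sum_mono[OF half])
  finally have "card {e \<in> E. e \<inter> (Q \<union> T) \<noteq> {} \<and> \<not> e \<subseteq> Q \<union> T} \<le> card (exits Q Z) + (\<Sum>z\<in>Z. deg z div 2)" by simp
  moreover have "s \<le> card {e \<in> E. e \<inter> (Q \<union> T) \<noteq> {} \<and> \<not> e \<subseteq> Q \<union> T}"
    by (rule cut[OF _ h(1) _ h'(1)]) (use Q Z h h' in \<open>auto simp: T_def\<close>)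
  ultimately show ?thesis by linarith
qed

text \<open>In the sum of the degrees over \<open>X\<close> an edge counts once, or twice if both of its ends are in \<open>X\<close>; the edges of the
second kind number at most \<open>2 * card X\<close>. Counting this way saves a factor of nearly two over the sum of all degrees,
and the constant in the final bound depends on it.\<close>

lemma card_hubs:
  assumes X: "X \<subseteq> V" and deg: "\<And>v. v \<in> X \<Longrightarrow> w + 2 \<le> deg v"
  shows "w * card X \<le> 2 * card V"
proof -
  have finX: "finite X" using X finite_V finite_subset by blast
  have "(w + 2) * card X \<le> (\<Sum>v\<in>X. deg v)"
    using sum_bounded_below[of X "w + 2" deg] deg by (simp add: mult.commute)
  also have "\<dots> = (\<Sum>v\<in>X. \<Sum>e\<in>E. of_bool (v \<in> e))"
    using finite_E by (intro sum.cong refl) (simp add: deg_def Int_def conj_commute)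
  also have "\<dots> = (\<Sum>e\<in>E. \<Sum>v\<in>X. of_bool (v \<in> e))" by (rule sum.swap)
  also have "\<dots> = (\<Sum>e\<in>E. card (X \<inter> e))"
    using finX by (intro sum.cong refl) (simp add: Int_def)
  also have "\<dots> \<le> (\<Sum>e\<in>E. 1 + of_bool (e \<subseteq> X))"
  proof (rule sum_mono)
    fix e assume e: "e \<in> E"
    have fine: "finite e" using edge_card[OF e] by (metis card.infinite zero_neq_numeral)
    show "card (X \<inter> e) \<le> 1 + of_bool (e \<subseteq> X)"
    proof (cases "e \<subseteq> X")
      case True
      then show ?thesis using edge_card[OF e] card_mono[OF fine, of "X \<inter> e"] by simp
    next
      case False
      then have "card (X \<inter> e) < card e" using fine by (intro psubset_card_mono) auto
      then show ?thesis using edge_card[OF e] by simp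
    qed
  qed
  also have "\<dots> = card E + card {e \<in> E. e \<subseteq> X}"
    unfolding sum.distrib using finite_E by (simp add: Int_def)
  also have "\<dots> \<le> 2 * card V + 2 * card X"
  proof -
    have "{e \<in> E. e \<subseteq> V} = E" using edge_sub by blast
    then show ?thesis using card_edges_le[OF K4_free, of V] card_edges_le[OF K4_free X] by simp
  qed
  finally show ?thesis by (simp add: algebra_simps)
qed

lemma egg_avoiding_neighbours:
  assumes "h \<in> S" "h \<inter> neighbours E C = {}" "h \<inter> C \<noteq> {}"
  shows "h \<subseteq> C"
proof (rule ccontr)
  assume "\<not> h \<subseteq> C"
  then have "touches E (h \<inter> C) (h - C)" using egg[OF assms(1)] assms(3) by (intro connected_in_crossing) auto
  then obtain x y where "x \<in> C" "y \<in> h" "y \<notin> C" "{x, y} \<in> E" by (auto simp: touches_def)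
  then have "y \<in> neighbours E C" by (auto simp: neighbours_def touches_def)
  then show False using assms(2) \<open>y \<in> h\<close> by blast
qed

text \<open>\<open>H\<close> is the hitting set so far and \<open>L\<close> the region where the remaining eggs live; only vertices of \<open>H\<close> are adjacent to
\<open>L\<close> from outside. Every step removes from \<open>L\<close> an attached set \<open>C\<close>, chosen minimal with an egg in \<open>C \<inter> L\<close>, and adds to
\<open>H\<close> its splitting vertex and at most one neighbour. By minimality the eggs left in \<open>C \<inter> L\<close> all contain the
splitting vertex. The at least \<open>w\<close> edges from \<open>C \<inter> L\<close> to the old \<open>H\<close> pay for the two new vertices, since they no
longer meet \<open>L\<close> afterwards.\<close>

lemma sweep:
  assumes X: "X \<subseteq> V" and low: "\<And>v. v \<in> V \<Longrightarrow> v \<notin> X \<Longrightarrow> deg v \<le> d"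
    and wd: "w + d div 2 \<le> s" "w + 1 < s"
    and D: "attached D" and D_min: "\<And>C h. attached C \<Longrightarrow> card C < card D \<Longrightarrow> h \<in> S \<Longrightarrow> h \<subseteq> C \<Longrightarrow> neighbours E C \<inter> X \<noteq> {}"
    and H: "H \<subseteq> V" "X \<union> neighbours E D \<subseteq> H" and L: "L \<subseteq> D" "L \<inter> H = {}" "neighbours E L \<subseteq> H"
    and eggs: "\<And>h. h \<in> S \<Longrightarrow> h \<inter> H = {} \<Longrightarrow> h \<subseteq> L"
  shows "\<exists>H' \<subseteq> V. (\<forall>h\<in>S. h \<inter> H' \<noteq> {}) \<and> w * card H' \<le> w * card H + 2 * card {e \<in> E. e \<inter> L \<noteq> {}}"
  using H L eggs
proof (induction "card L" arbitrary: H L rule: less_induct)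
  case less
  show ?case
  proof (cases "\<forall>h\<in>S. h \<inter> H \<noteq> {}")
    case True
    then show ?thesis using less.prems(1) by (intro exI[of _ H]) auto
  next
    case False
    then obtain h0 where h0: "h0 \<in> S" "h0 \<inter> H = {}" by blast
    define P where "P C \<longleftrightarrow> attached C \<and> (\<exists>h\<in>S. h \<subseteq> C \<inter> L)" for C
    have "h0 \<subseteq> L" using less.prems(6) h0 by blast
    then have "P D" using D h0(1) less.prems(3) unfolding P_def by blast
    then obtain C0 where C0: "P C0" "\<And>C'. P C' \<Longrightarrow> card C0 \<le> card C'"
      using ex_has_least_nat[of P D card] by blast
    \<comment> \<open>Preferring \<open>D\<close> in case of a tie ensures that \<open>D_min\<close> applies to \<open>C\<close> unless \<open>C\<close> is \<open>D\<close> itself.\<close>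
    define C where "C = (if card C0 = card D then D else C0)"
    have C: "P C" and C_min: "\<And>C'. P C' \<Longrightarrow> card C \<le> card C'"
      using C0 \<open>P D\<close> by (auto simp: C_def)
    have "card C0 \<le> card D" using C0(2) \<open>P D\<close> by blast
    then have CD: "C = D \<or> card C < card D" unfolding C_def by (cases "card C0 = card D") simp_all
    have CV: "C \<subseteq> V" "finite C" "attached C" and cardC: "card (neighbours E C) \<le> 2"
      using C attached_finite by (auto simp: P_def attached_def)
    obtain h1 where h1: "h1 \<in> S" "h1 \<subseteq> C \<inter> L" using C by (auto simp: P_def)
    define Z where "Z = neighbours E C - H"
    have finZ: "finite Z" and ZV: "Z \<subseteq> V" using finite_neighbours neighbours_sub by (auto simp: Z_def)
    have cardZ: "card Z \<le> 1"
    proof (cases "C = D")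
      case True
      then have "Z = {}" using less.prems(2) by (auto simp: Z_def)
      then show ?thesis by simp
    next
      case False
      then obtain x where x: "x \<in> neighbours E C" "x \<in> X" using D_min[OF CV(3) _ h1(1)] CD h1(2) by blast
      then have "card Z \<le> card (neighbours E C - {x})"
        using less.prems(2) finite_neighbours[of C] by (intro card_mono) (auto simp: Z_def)
      also have "\<dots> = card (neighbours E C) - 1" using x by simp
      finally show ?thesis using cardC by simp
    qed
    define Q where "Q = C \<inter> L"
    have QV: "Q \<subseteq> V" and QZ: "Q \<inter> Z = {}" using CV by (auto simp: Q_def Z_def neighbours_def)
    have exits_H: "e \<inter> H \<noteq> {}" if e: "e \<in> exits Q Z" for e
    proof -
      obtain x where x: "x \<in> e" "x \<in> Q" "e \<in> E" "\<not> e \<subseteq> Q \<union> Z" using e by (auto simp: exits_def)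
      obtain y where y: "e = {x, y}" using edge_elim[OF x(3,1)] by blast
      then have yn: "y \<notin> Q" "y \<notin> Z" using x by auto
      have "y \<in> H"
      proof (cases "y \<in> C")
        case True
        then have "y \<in> neighbours E L" using yn x y by (auto simp: Q_def neighbours_def touches_def)
        then show ?thesis using less.prems(5) by blast
      next
        case False
        then have "y \<in> neighbours E C" using x y by (auto simp: Q_def neighbours_def touches_def)
        then show ?thesis using yn by (auto simp: Z_def)
      qed
      then show ?thesis using y by blast
    qed
    obtain y where y: "y \<in> C" and ys: "\<forall>K. K \<noteq> {} \<and> connected_in E K \<and> K \<subseteq> C - {y} \<longrightarrow>
        (\<exists>C'. attached C' \<and> K \<subseteq> C' \<and> C' \<subseteq> C - {y})"
      using attached_split[OF K4_free CV(3)] by blast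
    have contains_y: "y \<in> h" if h: "h \<in> S" "h \<subseteq> C \<inter> L" for h
    proof (rule ccontr)
      assume "y \<notin> h"
      then have "\<exists>C'. attached C' \<and> h \<subseteq> C' \<and> C' \<subseteq> C - {y}"
        using egg[OF h(1)] h(2) by (intro ys[rule_format]) auto
      then obtain C' where C': "attached C'" "h \<subseteq> C'" "C' \<subseteq> C - {y}" by blast
      then have "P C'" using h unfolding P_def by blast
      moreover have "card C' < card C" using C'(3) y CV(2) by (intro psubset_card_mono) auto
      ultimately show False using C_min[of C'] by simp
    qed
    \<comment> \<open>Otherwise no egg lies beyond \<open>Z\<close>, and every egg contains \<open>y\<close>, a vertex of \<open>Z\<close>, or the end in \<open>Q\<close> of an exit.\<close>
    have many_exits: "w \<le> card (exits Q Z)"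
    proof (rule ccontr)
      assume "\<not> w \<le> card (exits Q Z)"
      then have few: "card (exits Q Z) \<le> w - 1" "w \<ge> 1" by auto
      have "(\<Sum>z\<in>Z. deg z div 2) \<le> (\<Sum>z\<in>Z. d div 2)"
        using ZV less.prems(2) by (intro sum_mono div_le_mono low) (auto simp: Z_def)
      also have "\<dots> \<le> d div 2" using cardZ by simp
      finally have "card (exits Q Z) + (\<Sum>z\<in>Z. deg z div 2) < s" using few wd(1) by linarith
      then have inside: "\<not> h \<subseteq> V - Q - Z" if "h \<in> S" for h
        using separated_eggs[OF QV ZV QZ h1(1) _ that] h1(2) by (auto simp: Q_def)
      have "\<forall>e\<in>exits Q Z. \<exists>x. x \<in> e \<inter> Q" by (auto simp: exits_def)
      then obtain r where r: "\<And>e. e \<in> exits Q Z \<Longrightarrow> r e \<in> e \<inter> Q" by metis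
      let ?R = "insert y (Z \<union> r ` exits Q Z)"
      have fin: "finite (exits Q Z)" using finite_E by (auto simp: exits_def)
      have "card ?R \<le> Suc (card (Z \<union> r ` exits Q Z))" by (simp add: card_insert_le_m1 card_insert_if finZ fin)
      also have "\<dots> \<le> Suc (card Z + card (r ` exits Q Z))" using card_Un_le by auto
      also have "\<dots> \<le> Suc (1 + (w - 1))"
        using cardZ few(1) card_image_le[OF fin, of r] by linarith
      also have "\<dots> < s" using few(2) wd(2) by linarith
      finally have "card ?R < s" .
      moreover have "s \<le> card ?R"
      proof (rule hit)
        show "?R \<subseteq> V" using y CV ZV r QV by blast
        fix h assume h: "h \<in> S"
        show "h \<inter> ?R \<noteq> {}"
        proof
          assume no: "h \<inter> ?R = {}"
          have hQ: "h \<inter> Q \<noteq> {}" using inside[OF h] egg[OF h] no by blast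
          have "h \<subseteq> Q"
          proof (rule ccontr)
            assume "\<not> h \<subseteq> Q"
            then have "touches E (h \<inter> Q) (h - Q)" using egg[OF h] hQ by (intro connected_in_crossing) auto
            then obtain u v where uv: "u \<in> h" "u \<in> Q" "v \<in> h" "v \<notin> Q" "{u, v} \<in> E" by (auto simp: touches_def)
            then have ex: "{u, v} \<in> exits Q Z" using no by (auto simp: exits_def)
            then have "r {u, v} = u" using r[OF ex] uv by auto
            then have "u \<in> ?R" using ex by (metis UnCI image_eqI insertCI)
            then show False using no uv by blast
          qed
          then show False using contains_y[OF h] no by (auto simp: Q_def)
        qed
      qed
      ultimately show False by simp
    qed
    define H' where "H' = insert y (H \<union> Z)"
    define L' where "L' = L - C - Z"
    have finH: "finite H" "finite L" using less.prems(1,3) finite_V attached_finite[OF D] finite_subset by blast+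
    have "h1 \<noteq> {}" using egg[OF h1(1)] by blast
    then have "L' \<subset> L" using h1(2) by (auto simp: L'_def)
    then have smaller: "card L' < card L" using finH by (intro psubset_card_mono)
    have "\<exists>H''\<subseteq>V. (\<forall>h\<in>S. h \<inter> H'' \<noteq> {}) \<and> w * card H'' \<le> w * card H' + 2 * card {e \<in> E. e \<inter> L' \<noteq> {}}"
    proof (rule less.hyps[OF smaller])
      show "H' \<subseteq> V" "X \<union> neighbours E D \<subseteq> H'" "L' \<subseteq> D" "L' \<inter> H' = {}"
        using less.prems(1-4) y CV ZV by (auto simp: H'_def L'_def)
      show "neighbours E L' \<subseteq> H'"
      proof
        fix x assume "x \<in> neighbours E L'"
        then obtain l where l: "x \<notin> L'" "l \<in> L'" "{l, x} \<in> E" by (auto simp: neighbours_def touches_def)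
        show "x \<in> H'"
        proof (cases "x \<in> L")
          case False
          then have "x \<in> neighbours E L" using l by (auto simp: neighbours_def touches_def L'_def)
          then show ?thesis using less.prems(5) by (auto simp: H'_def)
        next
          case True
          show ?thesis
          proof (cases "x \<in> C")
            case xC: True
            have "{x, l} \<in> E" using l(3) by (simp add: insert_commute)
            then have "l \<in> neighbours E C" using xC l(2) by (auto simp: neighbours_def touches_def L'_def)
            then show ?thesis using l(2) less.prems(4) by (auto simp: Z_def L'_def)
          next
            case False
            then show ?thesis using True l(1) by (auto simp: L'_def H'_def)
          qed
        qed
      qed
      fix h assume h: "h \<in> S" "h \<inter> H' = {}"
      have hL: "h \<subseteq> L" using less.prems(6) h by (auto simp: H'_def)
      have "h \<inter> C = {}"
      proof (rule ccontr)
        assume "h \<inter> C \<noteq> {}"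
        moreover have "h \<inter> neighbours E C = {}" using h(2) by (auto simp: H'_def Z_def)
        ultimately have "h \<subseteq> C" using egg_avoiding_neighbours h(1) by blast
        then show False using contains_y[OF h(1)] hL h(2) by (auto simp: H'_def)
      qed
      then show "h \<subseteq> L'" using hL h(2) by (auto simp: L'_def H'_def)
    qed
    then obtain H'' where H'': "H'' \<subseteq> V" "\<forall>h\<in>S. h \<inter> H'' \<noteq> {}"
      "w * card H'' \<le> w * card H' + 2 * card {e \<in> E. e \<inter> L' \<noteq> {}}" by blast
    have "card H' \<le> Suc (card (H \<union> Z))" by (simp add: H'_def card_insert_if finH finZ)
    also have "\<dots> \<le> Suc (card H + card Z)" using card_Un_le by auto
    finally have "card H' \<le> card H + 2" using cardZ by simp
    then have "w * card H' \<le> w * (card H + 2)" by (rule mult_le_mono2)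
    then have wH': "w * card H' \<le> w * card H + 2 * w" by (simp add: algebra_simps)
    have "exits Q Z \<inter> {e \<in> E. e \<inter> L' \<noteq> {}} = {}"
    proof -
      have "e \<inter> L' = {}" if e: "e \<in> exits Q Z" for e
      proof -
        obtain x where x: "x \<in> e" "x \<in> Q" "e \<in> E" using e by (auto simp: exits_def)
        obtain z where z: "e = {x, z}" using edge_elim[OF x(3,1)] by blast
        have "x \<notin> H" using x(2) less.prems(4) by (auto simp: Q_def)
        then have "z \<in> H" using exits_H[OF e] z by auto
        then show ?thesis using x(2) z less.prems(4) by (auto simp: Q_def L'_def)
      qed
      then show ?thesis by blast
    qed
    then have "card (exits Q Z) + card {e \<in> E. e \<inter> L' \<noteq> {}} = card (exits Q Z \<union> {e \<in> E. e \<inter> L' \<noteq> {}})"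
      using finite_E by (intro card_Un_disjoint[symmetric]) (auto simp: exits_def)
    also have "\<dots> \<le> card {e \<in> E. e \<inter> L \<noteq> {}}"
      using finite_E by (intro card_mono) (auto simp: exits_def Q_def L'_def)
    finally have "w + card {e \<in> E. e \<inter> L' \<noteq> {}} \<le> card {e \<in> E. e \<inter> L \<noteq> {}}" using many_exits by linarith
    then have "w * card H'' \<le> w * card H + 2 * card {e \<in> E. e \<inter> L \<noteq> {}}" using H''(3) wH' by linarith
    then show ?thesis using H''(1,2) by blast
  qed
qed

text \<open>With \<open>w\<close> near \<open>2 * t / 3\<close> and hubs of degree at least \<open>w + 2\<close>, a non-hub can be put on the cheaper side of a cut for
about \<open>w / 2\<close> edges. This leaves room for about \<open>s - w / 2\<close>, that is about \<open>w\<close>, further edges in a cut that is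
smaller than \<open>s\<close>, as \<open>sweep\<close> demands.\<close>

theorem order_bound:
  assumes s: "s = t + 4" "t \<ge> 1"
  shows "t * t \<le> 9 * card V"
proof -
  define w where "w = (2 * t + 2) div 3"
  have w: "2 * t \<le> 3 * w" "3 * w \<le> 2 * t + 2" "w \<ge> 1" using s(2) by (auto simp: w_def)
  define X where "X = {v \<in> V. w + 2 \<le> deg v}"
  have XV: "X \<subseteq> V" by (auto simp: X_def)
  have "\<exists>h. h \<in> S"
    using hit[of "{}"] s(1) by auto
  then obtain h0 where h0: "h0 \<in> S" by blast
  define P where "P C \<longleftrightarrow> attached C \<and> neighbours E C \<inter> X = {} \<and> (\<exists>h\<in>S. h \<subseteq> C)" for C
  obtain C0 where C0: "attached C0" "h0 \<subseteq> C0" "neighbours E C0 = {}"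
    using attached_component[of h0] egg[OF h0] by metis
  then have "P C0" using h0 by (auto simp: P_def)
  then obtain D where D: "P D" and D_min: "\<And>C. P C \<Longrightarrow> card D \<le> card C"
    using ex_has_least_nat[of P C0 card] by blast
  then obtain h1 where h1: "h1 \<in> S" "h1 \<subseteq> D" by (auto simp: P_def)
  have D': "attached D" "neighbours E D \<inter> X = {}" and DV: "D \<subseteq> V" and cardD: "card (neighbours E D) \<le> 2"
    using D by (auto simp: P_def attached_def)
  have "exits D (neighbours E D) = {}"
  proof -
    have False if e: "e \<in> exits D (neighbours E D)" for e
    proof -
      obtain x where x: "x \<in> e" "x \<in> D" "e \<in> E" "\<not> e \<subseteq> D \<union> neighbours E D" using e by (auto simp: exits_def)
      obtain y where y: "e = {x, y}" using edge_elim[OF x(3,1)] by blast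
      then have "y \<notin> D" "y \<notin> neighbours E D" using x by auto
      then show False using x y by (auto simp: neighbours_def touches_def)
    qed
    then show ?thesis by blast
  qed
  moreover have "(\<Sum>z\<in>neighbours E D. deg z div 2) \<le> 2 * ((w + 1) div 2)"
  proof -
    have "deg z \<le> w + 1" if "z \<in> neighbours E D" for z
    proof -
      have "z \<in> V" "z \<notin> X" using that D'(2) neighbours_sub by blast+
      then show ?thesis by (auto simp: X_def)
    qed
    then have "(\<Sum>z\<in>neighbours E D. deg z div 2) \<le> (\<Sum>z\<in>neighbours E D. (w + 1) div 2)"
      by (intro sum_mono div_le_mono)
    also have "\<dots> \<le> 2 * ((w + 1) div 2)" using cardD by simp
    finally show ?thesis .
  qed
  moreover have "2 * ((w + 1) div 2) < s" using w(2) s by simp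
  ultimately have small: "card (exits D (neighbours E D)) + (\<Sum>z\<in>neighbours E D. deg z div 2) < s" by simp
  have in_D: "h \<subseteq> D" if h: "h \<in> S" "h \<inter> neighbours E D = {}" for h
  proof -
    have disj: "D \<inter> neighbours E D = {}" by (auto simp: neighbours_def)
    have "\<not> h \<subseteq> V - D - neighbours E D"
      using separated_eggs[OF DV neighbours_sub disj h1 h(1)] small by linarith
    then have "h \<inter> D \<noteq> {}" using h egg[OF h(1)] by blast
    then show ?thesis using egg_avoiding_neighbours h by blast
  qed
  let ?H = "X \<union> neighbours E D" and ?L = "D - (X \<union> neighbours E D)"
  have "\<exists>H'\<subseteq>V. (\<forall>h\<in>S. h \<inter> H' \<noteq> {}) \<and> w * card H' \<le> w * card ?H + 2 * card {e \<in> E. e \<inter> ?L \<noteq> {}}"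
  proof (rule sweep[OF XV, of "w + 1" w D])
    show "deg v \<le> w + 1" if "v \<in> V" "v \<notin> X" for v using that by (auto simp: X_def)
    show "w + (w + 1) div 2 \<le> s" using w(2) s by linarith
    show "w + 1 < s" using w(2) s by linarith
    show "neighbours E C \<inter> X \<noteq> {}" if "attached C" "card C < card D" "h \<in> S" "h \<subseteq> C" for C h
      using D_min[of C] that by (auto simp: P_def)
    show "?H \<subseteq> V" using XV neighbours_sub by blast
    show "neighbours E ?L \<subseteq> ?H"
    proof
      fix x assume "x \<in> neighbours E ?L"
      then obtain l where l: "x \<notin> ?L" "l \<in> ?L" "{l, x} \<in> E" by (auto simp: neighbours_def touches_def)
      then show "x \<in> ?H" by (cases "x \<in> D") (auto simp: neighbours_def touches_def)
    qed
    show "h \<subseteq> ?L" if "h \<in> S" "h \<inter> ?H = {}" for h using in_D[of h] that by blast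
  qed (use D' in auto)
  then obtain H' where H': "H' \<subseteq> V" "\<forall>h\<in>S. h \<inter> H' \<noteq> {}"
    "w * card H' \<le> w * card ?H + 2 * card {e \<in> E. e \<inter> ?L \<noteq> {}}" by blast
  have sH: "s \<le> card H'" using H'(1,2) by (intro hit) auto
  have "card ?H \<le> card X + 2" using card_Un_le[of X "neighbours E D"] cardD by linarith
  then have "w * card ?H \<le> w * (card X + 2)" by (rule mult_le_mono2)
  moreover have "w * card X \<le> 2 * card V" by (rule card_hubs[OF XV]) (auto simp: X_def)
  moreover have "card {e \<in> E. e \<inter> ?L \<noteq> {}} \<le> 2 * card V"
  proof -
    have "card {e \<in> E. e \<inter> ?L \<noteq> {}} \<le> card {e \<in> E. e \<subseteq> V}"
      using finite_E edge_sub by (intro card_mono) auto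
    then show ?thesis using card_edges_le[OF K4_free, of V] by simp
  qed
  ultimately have "w * card H' \<le> 6 * card V + 2 * w" using H'(3) by (simp add: algebra_simps)
  moreover have "w * (t + 4) \<le> w * card H'" using sH s(1) by (intro mult_le_mono2) simp
  ultimately have "w * t \<le> 6 * card V" by (simp add: algebra_simps)
  moreover have "2 * t * t \<le> 3 * w * t" using w(1) by (rule mult_le_mono1)
  ultimately show ?thesis by linarith
qed

end

section \<open>From scrambles to families of eggs\<close>

lemma connected_graph_imp_connected_in:
  assumes H: "simple_graph H" "connected_graph H"
  shows "connected_in (edges H) (verts H)"
  unfolding connected_in_def
proof (intro allI impI)
  fix A assume A: "A \<noteq> {} \<and> A \<subset> verts H"
  then obtain u v where uv: "u \<in> A" "v \<in> verts H" "v \<notin> A" by blast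
  have "(u, v) \<in> {(x, y). {x, y} \<in> edges H}\<^sup>*" using H(2) uv A by (auto simp: connected_graph_def)
  then show "touches (edges H) A (verts H - A)" using uv(3)
  proof (induction rule: rtrancl_induct)
    case base
    then show ?case using uv(1) by blast
  next
    case (step x y)
    show ?case
    proof (cases "x \<in> A")
      case True
      have "{x, y} \<in> edges H" using step by simp
      moreover from this have "y \<in> verts H" using H(1) by (auto simp: simple_graph_def)
      ultimately show ?thesis using True step.prems unfolding touches_def by blast
    qed (use step in blast)
  qed
qed

lemma connected_in_mono_edges:
  assumes "connected_in E X" "\<And>e. e \<in> E \<Longrightarrow> e \<subseteq> X \<Longrightarrow> e \<in> E'"
  shows "connected_in E' X"
  unfolding connected_in_def
proof (intro allI impI)
  fix A assume A: "A \<noteq> {} \<and> A \<subset> X"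
  then have "touches E A (X - A)" using assms(1) by (auto simp: connected_in_def)
  then obtain x y where xy: "x \<in> A" "y \<in> X - A" "{x, y} \<in> E" by (auto simp: touches_def)
  then have "{x, y} \<in> E'" using A by (intro assms(2)) auto
  then show "touches E' A (X - A)" using xy unfolding touches_def by blast
qed

text \<open>A graph without edges is covered by \<open>F = {}\<close>: a K4 minor has edges.\<close>

lemma nearly_outerplanar_imp_K4_free:
  assumes G: "simple_graph G" "nearly_outerplanar k G"
  obtains F where "F \<subseteq> edges G" "card F \<le> k" "K4_free (verts G) (edges G - F)"
proof (cases "edges G = {}")
  case True
  then have "K4_free (verts G) (edges G - {})" by (auto simp: K4_free_def touches_def)
  then show ?thesis using that[of "{}"] by simp
next
  case False
  then obtain F where F: "F \<subseteq> edges G" "card F \<le> k" "outerplanar (delete_edges G F)"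
    using G(2) by (auto simp: nearly_outerplanar_def)
  have "simple_graph (delete_edges G F)" using G(1) by (auto simp: simple_graph_def delete_edges_def)
  then have "K4_free (verts G) (edges G - F)"
    using outerplanar_imp_K4_free[OF _ F(3)] by (simp add: delete_edges_def)
  then show ?thesis using that F by blast
qed

lemma scramble_order_le:
  assumes G: "simple_graph G" "scramble G S"
  shows "hitting_set G S X \<Longrightarrow> scramble_order G S \<le> card X"
    and "egg_cut G S C \<Longrightarrow> scramble_order G S \<le> card C"
proof -
  let ?m = "min (enat (hitting_size G S)) (egg_cut_size G S)"
  have "?m \<noteq> \<infinity>" by (metis enat_ord_simps(4) infinity_ileE min.cobounded1)
  then have m: "enat (scramble_order G S) = ?m" unfolding scramble_order_def by (cases ?m) auto
  show "scramble_order G S \<le> card X" if "hitting_set G S X"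
  proof -
    have "hitting_size G S \<le> card X"
      unfolding hitting_size_def using that hitting_sets_finite_nonempty(1)[OF G] by (intro Min_le) auto
    moreover have "enat (scramble_order G S) \<le> enat (hitting_size G S)" unfolding m by simp
    ultimately show ?thesis by simp
  qed
  show "scramble_order G S \<le> card C" if "egg_cut G S C"
  proof -
    have "egg_cut_size G S \<le> enat (card C)"
      unfolding egg_cut_size_def using that by (intro INF_lower) auto
    moreover have "enat (scramble_order G S) \<le> egg_cut_size G S" unfolding m by simp
    ultimately show ?thesis using order_trans enat_ord_simps(1) by blast
  qed
qed

text \<open>Choose one end of each edge in \<open>F\<close>. An egg that avoids these at most \<open>k\<close> vertices contains no edge of \<open>F\<close>, so it stays
connected when \<open>F\<close> is deleted. Adding the chosen vertices to a set hitting all such eggs, or the edges of \<open>F\<close> to a cut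
between two of them, gives a hitting set or an egg-cut of the scramble.\<close>

lemma scramble_imp_egg_family:
  assumes G: "simple_graph G" and S: "scramble G S"
    and F: "F \<subseteq> edges G" "card F \<le> k" "K4_free (verts G) (edges G - F)"
  obtains S' where "egg_family (verts G) (edges G - F) S' (scramble_order G S - k)"
proof -
  let ?V = "verts G" and ?E = "edges G - F" and ?s = "scramble_order G S"
  have finV: "finite ?V" and edge: "\<And>e. e \<in> edges G \<Longrightarrow> e \<subseteq> ?V \<and> card e = 2"
    using G by (auto simp: simple_graph_def)
  have finE: "finite (edges G)" using finite_edges[OF G] .
  have finF: "finite F" using F(1) finE finite_subset by blast
  have "\<exists>x. x \<in> e" if "e \<in> F" for e
  proof -
    have "e \<noteq> {}" using edge[of e] that F(1) by auto
    then show ?thesis by blast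
  qed
  then obtain r where r: "\<And>e. e \<in> F \<Longrightarrow> r e \<in> e" by metis
  define R where "R = r ` F"
  have RV: "R \<subseteq> ?V" using r edge F(1) unfolding R_def by blast
  have cardR: "card R \<le> k" using card_image_le[OF finF, of r] F(2) by (simp add: R_def)
  define S' where "S' = {verts H | H. H \<in> S \<and> verts H \<inter> R = {}}"
  have SH: "subgraph H G" "connected_graph H" "verts H \<noteq> {}" if "H \<in> S" for H
    using S that by (auto simp: scramble_def)
  have "egg_family ?V ?E S' (?s - k)"
  proof
    show "finite ?V" by (rule finV)
    show "e \<subseteq> ?V" "card e = 2" if "e \<in> ?E" for e using edge[of e] that by auto
    show "K4_free ?V ?E" by (rule F(3))
    show "h \<subseteq> ?V \<and> h \<noteq> {} \<and> connected_in ?E h" if "h \<in> S'" for h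
    proof -
      obtain H where H: "H \<in> S" "h = verts H" "verts H \<inter> R = {}" using \<open>h \<in> S'\<close> by (auto simp: S'_def)
      have sub: "simple_graph H" "verts H \<subseteq> ?V" "edges H \<subseteq> edges G"
        using SH(1)[OF H(1)] by (auto simp: subgraph_def)
      have "connected_in ?E h"
      proof (rule connected_in_mono_edges)
        show "connected_in (edges H) h"
          unfolding H(2) using sub(1) SH(2)[OF H(1)] by (rule connected_graph_imp_connected_in)
        show "e \<in> ?E" if e: "e \<in> edges H" "e \<subseteq> h" for e
        proof -
          have "e \<notin> F"
          proof
            assume "e \<in> F"
            then have "r e \<in> R" "r e \<in> e" using r by (auto simp: R_def)
            then show False using e(2) H(2,3) by blast
          qed
          then show ?thesis using e(1) sub(3) by blast
        qed
      qed
      then show ?thesis using sub(2) SH(3)[OF H(1)] H(2) by blast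
    qed
    show "?s - k \<le> card X" if X: "X \<subseteq> ?V" "\<And>h. h \<in> S' \<Longrightarrow> h \<inter> X \<noteq> {}" for X
    proof -
      have "hitting_set G S (X \<union> R)"
        unfolding hitting_set_def
      proof (intro conjI ballI)
        show "X \<union> R \<subseteq> ?V" using X(1) RV by blast
        fix H assume "H \<in> S"
        then show "(X \<union> R) \<inter> verts H \<noteq> {}" using X(2)[of "verts H"] by (auto simp: S'_def)
      qed
      then have "?s \<le> card (X \<union> R)" by (rule scramble_order_le(1)[OF G S])
      then show ?thesis using card_Un_le[of X R] cardR by linarith
    qed
    show "?s - k \<le> card {e \<in> ?E. e \<inter> A \<noteq> {} \<and> \<not> e \<subseteq> A}"
      if A: "A \<subseteq> ?V" "h \<in> S'" "h \<subseteq> A" "h' \<in> S'" "h' \<subseteq> ?V - A" for A h h'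
    proof -
      obtain H H' where HH: "H \<in> S" "h = verts H" "H' \<in> S" "h' = verts H'"
        using A(2,4) by (auto simp: S'_def)
      have "egg_cut G S (cut_edges G A (?V - A))"
        unfolding egg_cut_def using A HH by (intro exI[of _ A] exI[of _ "?V - A"]) auto
      then have "?s \<le> card (cut_edges G A (?V - A))" by (rule scramble_order_le(2)[OF G S])
      also have "\<dots> \<le> card ({e \<in> ?E. e \<inter> A \<noteq> {} \<and> \<not> e \<subseteq> A} \<union> F)"
        using finE finF by (intro card_mono) (auto simp: cut_edges_def)
      also have "\<dots> \<le> card {e \<in> ?E. e \<inter> A \<noteq> {} \<and> \<not> e \<subseteq> A} + card F" by (rule card_Un_le)
      finally show ?thesis using F(2) by linarith
    qed
  qed
  then show thesis by (rule that)
qed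

theorem corollary4p5:
  fixes G :: "'a graph" and k n :: nat
  assumes "simple_graph G"
    and "connected_graph G"
    and "nearly_outerplanar k G"
    and "n = card (verts G)"
  shows "real (scramble_number G) \<le> (2 + sqrt 2) * sqrt (real n) + 4 + real k"
proof -
  obtain F where F: "F \<subseteq> edges G" "card F \<le> k" "K4_free (verts G) (edges G - F)"
    using nearly_outerplanar_imp_K4_free[OF assms(1,3)] .
  have "scramble_number G \<in> scramble_order G ` {S. scramble G S}"
    unfolding scramble_number_def
    using scrambles_finite_nonempty[OF assms(1)] by (intro Max_in) auto
  then obtain S where S: "scramble G S" "scramble_number G = scramble_order G S" by blast
  obtain S' where S': "egg_family (verts G) (edges G - F) S' (scramble_order G S - k)"
    using scramble_imp_egg_family[OF assms(1) S(1) F] .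
  have "real (scramble_number G) \<le> 3 * sqrt (real n) + 4 + real k"
  proof (cases "scramble_number G \<le> k + 4")
    case True
    then have "real (scramble_number G) \<le> 4 + real k" by linarith
    moreover have "0 \<le> 3 * sqrt (real n)" by simp
    ultimately show ?thesis by linarith
  next
    case False
    define t where "t = scramble_number G - k - 4"
    have t: "scramble_order G S - k = t + 4" "t \<ge> 1" "scramble_number G = t + 4 + k"
      using False S(2) by (auto simp: t_def)
    have "t * t \<le> 9 * n" using egg_family.order_bound[OF S' t(1,2)] assms(4) by simp
    then have "(real t)\<^sup>2 \<le> 9 * real n" by (metis of_nat_le_iff of_nat_mult of_nat_numeral power2_eq_square)
    also have "\<dots> = (3 * sqrt (real n))\<^sup>2" by (simp add: power_mult_distrib)
    finally have "real t \<le> 3 * sqrt (real n)" by (rule power2_le_imp_le) simp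
    then show ?thesis using t(3) by simp
  qed
  also have "3 * sqrt (real n) \<le> (2 + sqrt 2) * sqrt (real n)"
    by (intro mult_right_mono) auto
  finally show ?thesis by simp
qed

end
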